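(* Let $\lambda$ be the regularization parameter and $S$ the set of densities in the definition of the information complexity minimization estimator $\hat{w}_X^S$ (see context). Let $\alpha>0$. Then for all $\rho\in(0,1)$ and $\gamma\ge\rho$ such that $\lambda'=\frac{\lambda\gamma-1}{\gamma-\rho}\ge 0$ (if $\gamma=\rho$, it is required that $\lambda\gamma=1$, and one sets $\lambda'=0$), we have $$\mathbf{E}_X\mathbf{E}_\pi\hat{w}_X^S(\theta)D_\rho(q\|p(\cdot|\theta))\le \mathbf{E}_X\mathbf{E}_\pi\hat{w}_X^S(\theta)D_\rho^{\mathrm{Re}}(q\|p(\cdot|\theta))\le \frac{\gamma\inf_{w\in S}R_\lambda(w)}{\alpha\rho(1-\rho)}-\frac{\gamma-\rho}{\alpha\rho(1-\rho)}\mathbf{E}_X\hat{R}_{\lambda'}(\hat{w}_X^S)+\frac{c_{\rho,n}(\alpha)}{\alpha\rho(1-\rho)},$$ where $$c_{\rho,n}(\alpha)=\frac1n\ln\mathbf{E}_\pi\left(\mathbf{E}_q\Big(\frac{p(x|\theta)}{q(x)}\Big)^\rho\right)^{(1-\alpha)n}=\frac1n\ln\mathbf{E}_\pi e^{-\rho(1-\rho)(1-\alpha)nD_\rho^{\mathrm{Re}}(q\|p(\cdot|\theta))}.$$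
   Context: $\mathcal{X}$ is a sample space with a measure $\mu$; $q$ is a probability density with respect to $\mu$ (the true density); $X=(X_1,\dots,X_n)$ are $n$ independent samples from $q$; $\mathbf{E}_X$ is expectation over $X$ and $\mathbf{E}_q$ expectation over a single $x\sim q$. $\{p(\cdot|\theta):\theta\in\Gamma\}$ is a family of probability densities with respect to $\mu$ ($q$ need not belong to it); $\pi$ is a probability measure (prior) on $\Gamma$ not depending on $X$; $\mathbf{E}_\pi f(\theta)=\int_\Gamma f\,d\pi$. For a density $w$ on $\Gamma$ with respect to $\pi$, $D_{\mathrm{KL}}(w\,d\pi\|d\pi)=\int_\Gamma w\ln w\,d\pi$. For densities, $D_{\mathrm{KL}}(q\|p)=\mathbf{E}_q\ln(q(x)/p(x))$, and for $\rho\in(0,1)$ $$D_\rho(q\|p)=\frac{1}{\rho(1-\rho)}\mathbf{E}_q\Big[1-\Big(\frac{p(x)}{q(x)}\Big)^\rho\Big],\qquad D_\rho^{\mathrm{Re}}(q\|p)=-\frac{1}{\rho(1-\rho)}\ln\mathbf{E}_q\Big(\frac{p(x)}{q(x)}\Big)^\rho .$$ For a real parameter $\lambda\ge 0$, $$\hat{R}_\lambda(w)=\frac1n\mathbf{E}_\pi w(\theta)\sum_{i=1}^n\ln\frac{q(X_i)}{p(X_i|\theta)}+\frac{\lambda}{n}D_{\mathrm{KL}}(w\,d\pi\|d\pi),\qquad R_\lambda(w)=\mathbf{E}_\pi w(\theta)D_{\mathrm{KL}}(q\|p(\cdot|\theta))+\frac{\lambda}{n}D_{\mathrm{KL}}(w\,d\pi\|d\pi).$$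 $S$ is a predefined set of densities on $\Gamma$ with respect to $\pi$. The information complexity minimization estimator is $$\hat{w}_X^S=\arg\min_{w\in S}\Big[-\mathbf{E}_\pi w(\theta)\sum_{i=1}^n\ln p(X_i|\theta)+\lambda D_{\mathrm{KL}}(w\,d\pi\|d\pi)\Big]=\arg\min_{w\in S}\hat{R}_\lambda(w)$$ (a minimizer, assumed to exist). All quantities are assumed measurable, and the expressions appearing are assumed to be well defined. *)

theory Defs
  imports "HOL-Probability.Probability"
begin

text \<open>
  Log-likelihood ratios, divergences and risks may be infinite (for instance where a model density
  vanishes), so they are taken in the extended reals. There \<open>0 * \<infinity> = 0\<close>, \<open>a / 0 = \<infinity>\<close> for \<open>a > 0\<close>,
  and \<open>\<infinity> - \<infinity> = \<infinity>\<close>; the last of these is never relied on, since expressions that could take the form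
  \<open>\<infinity> - \<infinity>\<close> are guarded by the predicates \<open>sum_defined\<close> and \<open>ext_integral_defined\<close>, unless they carry
  the coefficient \<open>0\<close>.
\<close>

definition eln :: "ereal \<Rightarrow> ereal" where
  "eln x = (if x \<le> 0 then -\<infinity> else if x = \<infinity> then \<infinity> else ereal (ln (real_of_ereal x)))"

definition eexp :: "ereal \<Rightarrow> ereal" where
  "eexp x = (if x = -\<infinity> then 0 else if x = \<infinity> then \<infinity> else ereal (exp (real_of_ereal x)))"

text \<open>
  Real powers of a nonnegative base. The library's \<open>powr\<close> gives \<open>0 powr s = 0\<close> for every \<open>s\<close>, which
  is wrong for \<open>s \<le> 0\<close>.
\<close>

definition epowr :: "real \<Rightarrow> real \<Rightarrow> ereal" where
  "epowr x s = (if x = 0 then (if s < 0 then \<infinity> else if s = 0 then 1 else 0) else ereal (x powr s))"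

text \<open>
  Expectation of an extended-real function. The Bochner integral is not suitable, because it
  assigns \<open>0\<close> to functions that are not integrable; for the same reason \<open>KL_divergence\<close> is not used.
\<close>

definition ext_integral :: "'a measure \<Rightarrow> ('a \<Rightarrow> ereal) \<Rightarrow> ereal" where
  "ext_integral M f =
     enn2ereal (\<integral>\<^sup>+x. e2ennreal (f x) \<partial>M) - enn2ereal (\<integral>\<^sup>+x. e2ennreal (- f x) \<partial>M)"

definition ext_integral_defined :: "'a measure \<Rightarrow> ('a \<Rightarrow> ereal) \<Rightarrow> bool" where
  "ext_integral_defined M f \<longleftrightarrow>
     \<not> ((\<integral>\<^sup>+x. e2ennreal (f x) \<partial>M) = \<infinity> \<and> (\<integral>\<^sup>+x. e2ennreal (- f x) \<partial>M) = \<infinity>)"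

text \<open>A sum with the given summands is not of the form \<open>\<infinity> - \<infinity>\<close>.\<close>

definition sum_defined :: "ereal set \<Rightarrow> bool" where
  "sum_defined A \<longleftrightarrow> \<not> (\<infinity> \<in> A \<and> -\<infinity> \<in> A)"

definition prob_density :: "'a measure \<Rightarrow> ('a \<Rightarrow> real) \<Rightarrow> bool" where
  "prob_density M f \<longleftrightarrow> f \<in> borel_measurable M \<and> (\<forall>x\<in>space M. 0 \<le> f x) \<and>
     (\<integral>\<^sup>+x. ennreal (f x) \<partial>M) = 1"

definition law :: "'a measure \<Rightarrow> ('a \<Rightarrow> real) \<Rightarrow> 'a measure" where
  "law \<mu> q = density \<mu> (\<lambda>x. ennreal (q x))"

definition sample_law :: "'a measure \<Rightarrow> ('a \<Rightarrow> real) \<Rightarrow> nat \<Rightarrow> (nat \<Rightarrow> 'a) measure" where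
  "sample_law \<mu> q n = Pi\<^sub>M {..<n} (\<lambda>_. law \<mu> q)"

text \<open>\<open>D\<^sub>K\<^sub>L(w d\<pi> || d\<pi>)\<close>; always well defined, as \<open>w ln w\<close> is bounded below.\<close>

definition KL_prior :: "'t measure \<Rightarrow> ('t \<Rightarrow> real) \<Rightarrow> ereal" where
  "KL_prior \<pi> w = ext_integral \<pi> (\<lambda>\<theta>. ereal (w \<theta> * ln (w \<theta>)))"

text \<open>
  Divergences between densities with respect to \<open>\<mu>\<close>. Points with \<open>q x = 0\<close> are null for
  \<open>law \<mu> q\<close>. The negative part of \<open>ln (q / p)\<close> is integrable, since
  \<open>ln (p / q) \<le> p / q\<close>, so \<open>D_KL\<close> is always well defined. The integrands of \<open>rho_affinity\<close> and \<open>D_rho\<close>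
  are integrable, since \<open>(p / q)\<^bsup>\<rho>\<^esup> \<le> 1 + p / q\<close>.
\<close>

definition D_KL :: "'a measure \<Rightarrow> ('a \<Rightarrow> real) \<Rightarrow> ('a \<Rightarrow> real) \<Rightarrow> ereal" where
  "D_KL \<mu> q p = ext_integral (law \<mu> q) (\<lambda>x. eln (ereal (q x) / ereal (p x)))"

definition rho_affinity :: "'a measure \<Rightarrow> real \<Rightarrow> ('a \<Rightarrow> real) \<Rightarrow> ('a \<Rightarrow> real) \<Rightarrow> real" where
  "rho_affinity \<mu> \<rho> q p = (\<integral>x. (p x / q x) powr \<rho> \<partial>law \<mu> q)"

definition D_rho :: "'a measure \<Rightarrow> real \<Rightarrow> ('a \<Rightarrow> real) \<Rightarrow> ('a \<Rightarrow> real) \<Rightarrow> real" where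
  "D_rho \<mu> \<rho> q p = 1 / (\<rho> * (1 - \<rho>)) * (\<integral>x. 1 - (p x / q x) powr \<rho> \<partial>law \<mu> q)"

definition D_Re :: "'a measure \<Rightarrow> real \<Rightarrow> ('a \<Rightarrow> real) \<Rightarrow> ('a \<Rightarrow> real) \<Rightarrow> ereal" where
  "D_Re \<mu> \<rho> q p = - (ereal (1 / (\<rho> * (1 - \<rho>))) * eln (ereal (rho_affinity \<mu> \<rho> q p)))"

text \<open>
  In what follows \<open>\<pi>\<close> is the prior, with \<open>\<Gamma> = space \<pi>\<close>, and \<open>p \<theta>\<close> is the density \<open>p(\<cdot>|\<theta>)\<close>.
\<close>

definition emp_log_ratio ::
  "('a \<Rightarrow> real) \<Rightarrow> ('t \<Rightarrow> 'a \<Rightarrow> real) \<Rightarrow> nat \<Rightarrow> (nat \<Rightarrow> 'a) \<Rightarrow> ('t \<Rightarrow> real) \<Rightarrow> 't \<Rightarrow> ereal"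
where
  "emp_log_ratio q p n X w =
     (\<lambda>\<theta>. ereal (w \<theta>) * (\<Sum>i<n. eln (ereal (q (X i)) / ereal (p \<theta> (X i)))))"

definition R_hat ::
  "('a \<Rightarrow> real) \<Rightarrow> ('t \<Rightarrow> 'a \<Rightarrow> real) \<Rightarrow> 't measure \<Rightarrow> nat \<Rightarrow> real \<Rightarrow> (nat \<Rightarrow> 'a) \<Rightarrow> ('t \<Rightarrow> real) \<Rightarrow> ereal"
where
  "R_hat q p \<pi> n lam X w =
     ereal (1 / real n) * ext_integral \<pi> (emp_log_ratio q p n X w)
     + ereal (lam / real n) * KL_prior \<pi> w"

definition R_hat_defined ::
  "('a \<Rightarrow> real) \<Rightarrow> ('t \<Rightarrow> 'a \<Rightarrow> real) \<Rightarrow> 't measure \<Rightarrow> nat \<Rightarrow> real \<Rightarrow> (nat \<Rightarrow> 'a) \<Rightarrow> ('t \<Rightarrow> real) \<Rightarrow> bool"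
where
  "R_hat_defined q p \<pi> n lam X w \<longleftrightarrow>
     ext_integral_defined \<pi> (emp_log_ratio q p n X w) \<and>
     sum_defined {ereal (1 / real n) * ext_integral \<pi> (emp_log_ratio q p n X w),
                  ereal (lam / real n) * KL_prior \<pi> w}"

definition R_true ::
  "'a measure \<Rightarrow> ('a \<Rightarrow> real) \<Rightarrow> ('t \<Rightarrow> 'a \<Rightarrow> real) \<Rightarrow> 't measure \<Rightarrow> nat \<Rightarrow> real \<Rightarrow> ('t \<Rightarrow> real) \<Rightarrow> ereal"
where
  "R_true \<mu> q p \<pi> n lam w =
     ext_integral \<pi> (\<lambda>\<theta>. ereal (w \<theta>) * D_KL \<mu> q (p \<theta>)) + ereal (lam / real n) * KL_prior \<pi> w"

definition log_lik ::
  "('t \<Rightarrow> 'a \<Rightarrow> real) \<Rightarrow> nat \<Rightarrow> (nat \<Rightarrow> 'a) \<Rightarrow> ('t \<Rightarrow> real) \<Rightarrow> 't \<Rightarrow> ereal"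
where
  "log_lik p n X w = (\<lambda>\<theta>. ereal (w \<theta>) * (\<Sum>i<n. eln (ereal (p \<theta> (X i)))))"

definition icm_objective ::
  "('t \<Rightarrow> 'a \<Rightarrow> real) \<Rightarrow> 't measure \<Rightarrow> nat \<Rightarrow> real \<Rightarrow> (nat \<Rightarrow> 'a) \<Rightarrow> ('t \<Rightarrow> real) \<Rightarrow> ereal"
where
  "icm_objective p \<pi> n lam X w =
     - ext_integral \<pi> (log_lik p n X w) + ereal lam * KL_prior \<pi> w"

definition icm_objective_defined ::
  "('t \<Rightarrow> 'a \<Rightarrow> real) \<Rightarrow> 't measure \<Rightarrow> nat \<Rightarrow> real \<Rightarrow> (nat \<Rightarrow> 'a) \<Rightarrow> ('t \<Rightarrow> real) \<Rightarrow> bool"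
where
  "icm_objective_defined p \<pi> n lam X w \<longleftrightarrow>
     ext_integral_defined \<pi> (log_lik p n X w) \<and>
     sum_defined {- ext_integral \<pi> (log_lik p n X w), ereal lam * KL_prior \<pi> w}"

text \<open>
  \<open>v\<close> attains the minimum of the objective over \<open>S\<close> at the sample \<open>X\<close>. Minimizers need not be
  unique; an estimator is any selection of them.
\<close>

definition is_icm_minimizer ::
  "('t \<Rightarrow> 'a \<Rightarrow> real) \<Rightarrow> 't measure \<Rightarrow> nat \<Rightarrow> real \<Rightarrow> ('t \<Rightarrow> real) set \<Rightarrow> (nat \<Rightarrow> 'a) \<Rightarrow> ('t \<Rightarrow> real) \<Rightarrow> bool"
where
  "is_icm_minimizer p \<pi> n lam S X v \<longleftrightarrow>
     is_arg_min (icm_objective p \<pi> n lam X) (\<lambda>w. w \<in> S) v"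

definition c_const ::
  "'a measure \<Rightarrow> ('a \<Rightarrow> real) \<Rightarrow> ('t \<Rightarrow> 'a \<Rightarrow> real) \<Rightarrow> 't measure \<Rightarrow> nat \<Rightarrow> real \<Rightarrow> real \<Rightarrow> ereal"
where
  "c_const \<mu> q p \<pi> n \<rho> \<alpha> = ereal (1 / real n) *
     eln (ext_integral \<pi> (\<lambda>\<theta>. epowr (rho_affinity \<mu> \<rho> q (p \<theta>)) ((1 - \<alpha>) * real n)))"

end

theory Submission
  imports Defs
begin

text \<open>
  Write \<open>L X \<theta> = \<Sum>\<^sub>i ln (q (X i) / p \<theta> (X i))\<close>, \<open>A \<theta>\<close> for the affinity \<open>E\<^sub>q (p \<theta> / q)\<^bsup>\<rho>\<^esup>\<close>, and \<open>W X\<close>, \<open>V X\<close> for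
  the mean of \<open>- ln A\<close> under the estimator \<open>w = w_hat X\<close> and for its divergence \<open>\<integral> w ln w d\<pi>\<close>. Since
  \<open>D_Re = - ln A / (\<rho> (1 - \<rho>))\<close>, the task is to bound the expectation of \<open>W\<close>. The first inequality
  is \<open>1 - A \<le> - ln A\<close>.

  For the second, the tilted likelihood \<open>g X \<theta> = exp (- \<rho> L X \<theta>) A \<theta>\<^bsup>- \<alpha> n\<^esup>\<close> has sample expectation
  \<open>A \<theta>\<^bsup>(1 - \<alpha>) n\<^esup>\<close> where \<open>A \<theta> > 0\<close>, by independence (\<open>nn_integral_tilted_le\<close>), hence mass at most
  \<open>G = exp (n c_const)\<close> over sample and prior. The
  scalar inequality \<open>w ln (g / G) \<le> w ln w - w + g / G\<close> (\<open>young_entropy\<close>), integrated over the prior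
  (\<open>entropy_bound\<close>) and then over the sample, gives
  \<open>\<alpha> n E W \<le> E [\<rho> \<integral> w L d\<pi> + V] + ln G\<close>; the terms \<open>- w\<close> and \<open>g / G\<close> contribute at most
  \<open>- 1 + 1 = 0\<close>. Thus the duality of entropy and the concavity of \<open>ln\<close> in the sample are handled in one step.
  As \<open>(\<gamma> - \<rho>) lam' = lam \<gamma> - 1\<close>, the bracket equals \<open>\<gamma> n R_hat\<^bsub>lam\<^esub> - (\<gamma> - \<rho>) n R_hat\<^bsub>lam'\<^esub>\<close>, and
  the minimality of \<open>w_hat X\<close> together with \<open>E R_hat\<^bsub>lam\<^esub> w = R_true\<^bsub>lam\<^esub> w\<close> for fixed \<open>w\<close> (\<open>expected_empirical_risk\<close>)
  yields the bound for each \<open>w \<in> S\<close> (\<open>icm_risk_bound\<close>); the infimum over \<open>w\<close> comes last.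

  What remains is to exclude infinities. If the infimal risk, \<open>c_const\<close> or \<open>- (\<gamma> - \<rho>) E R_hat\<^bsub>lam'\<^esub>\<close> is
  \<open>\<infinity>\<close>, so is the right-hand side. Otherwise some competitor has finite risk, hence almost surely a
  finite objective, so the estimator has one as well. As \<open>lam > 0\<close>, its divergence is then finite, and
  it gives no mass to parameters under which some observation has density \<open>0\<close>; in particular it
  gives none to \<open>A = 0\<close>. The inequality above, read as a lower bound for \<open>\<integral> w L d\<pi>\<close>, supplies the
  remaining integrability.
\<close>

section \<open>Extended-real integrals\<close>

lemma ext_integral_mono_AE:
  assumes "AE x in M. f x \<le> g x"
  shows "ext_integral M f \<le> ext_integral M g"
  unfolding ext_integral_def
proof (rule ereal_minus_mono)
  show "enn2ereal (\<integral>\<^sup>+x. e2ennreal (f x) \<partial>M) \<le> enn2ereal (\<integral>\<^sup>+x. e2ennreal (g x) \<partial>M)"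
    unfolding less_eq_ennreal.rep_eq[symmetric]
    by (rule nn_integral_mono_AE, use assms in eventually_elim) (rule e2ennreal_mono)
  show "enn2ereal (\<integral>\<^sup>+x. e2ennreal (- g x) \<partial>M) \<le> enn2ereal (\<integral>\<^sup>+x. e2ennreal (- f x) \<partial>M)"
    unfolding less_eq_ennreal.rep_eq[symmetric]
    by (rule nn_integral_mono_AE, use assms in eventually_elim) (auto intro: e2ennreal_mono)
qed

lemma ext_integral_cong_AE:
  assumes "AE x in M. f x = g x"
  shows "ext_integral M f = ext_integral M g"
  by (intro antisym ext_integral_mono_AE) (use assms in eventually_elim, simp)+

lemma ext_integral_ereal:
  assumes "integrable M f"
  shows "ext_integral M (\<lambda>x. ereal (f x)) = ereal (\<integral>x. f x \<partial>M)"
proof -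
  have "(\<integral>\<^sup>+x. ennreal (f x) \<partial>M) \<noteq> \<infinity>" "(\<integral>\<^sup>+x. ennreal (- f x) \<partial>M) \<noteq> \<infinity>"
    using assms unfolding real_integrable_def by auto
  then obtain a b where ab: "(\<integral>\<^sup>+x. ennreal (f x) \<partial>M) = ennreal a" "0 \<le> a"
      "(\<integral>\<^sup>+x. ennreal (- f x) \<partial>M) = ennreal b" "0 \<le> b"
    by (metis ennreal_cases infinity_ennreal_def)
  show ?thesis
    unfolding ext_integral_def real_lebesgue_integral_def[OF assms]
    using ab by (simp add: enn2ereal_ennreal)
qed

lemma ext_integral_eq_nn_integral:
  assumes "AE x in M. 0 \<le> f x"
  shows "ext_integral M f = enn2ereal (\<integral>\<^sup>+x. e2ennreal (f x) \<partial>M)"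
proof -
  have "(\<integral>\<^sup>+x. e2ennreal (- f x) \<partial>M) = (\<integral>\<^sup>+x. 0 \<partial>M)"
    by (rule nn_integral_cong_AE, use assms in eventually_elim) (auto simp: e2ennreal_neg)
  then show ?thesis
    by (simp add: ext_integral_def zero_ennreal.rep_eq)
qed

text \<open>
  An infinite positive part forces the value \<open>\<infinity>\<close>, whatever the negative part, as \<open>\<infinity> - \<infinity> = \<infinity>\<close>.
\<close>

lemma nn_integral_less_top_if_ext_integral_less_top:
  assumes "ext_integral M f < \<infinity>"
  shows "(\<integral>\<^sup>+x. e2ennreal (f x) \<partial>M) < \<infinity>"
proof (rule ccontr)
  assume "\<not> ?thesis"
  then have "(\<integral>\<^sup>+x. e2ennreal (f x) \<partial>M) = \<infinity>"
    by (simp add: less_top[symmetric])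
  then show False
    using assms by (simp add: ext_integral_def top_ennreal.rep_eq top_ereal_def)
qed

lemma nn_integral_neg_less_top_if_ext_integral_greater_bot:
  assumes "-\<infinity> < ext_integral M f" and "ext_integral_defined M f"
  shows "(\<integral>\<^sup>+x. e2ennreal (- f x) \<partial>M) < \<infinity>"
proof (rule ccontr)
  assume "\<not> ?thesis"
  then have N: "(\<integral>\<^sup>+x. e2ennreal (- f x) \<partial>M) = \<infinity>"
    by (simp add: less_top[symmetric])
  with assms(2) obtain a where "(\<integral>\<^sup>+x. e2ennreal (f x) \<partial>M) = ennreal a" "0 \<le> a"
    unfolding ext_integral_defined_def by (metis ennreal_cases infinity_ennreal_def)
  then show False
    using assms(1) N by (simp add: ext_integral_def top_ennreal.rep_eq top_ereal_def enn2ereal_ennreal)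
qed

lemma integrable_if_parts_finite:
  fixes f :: "'a \<Rightarrow> real"
  assumes "f \<in> borel_measurable M" "(\<integral>\<^sup>+x. ennreal (f x) \<partial>M) < \<infinity>" "(\<integral>\<^sup>+x. ennreal (- f x) \<partial>M) < \<infinity>"
  shows "integrable M f"
  using assms by (simp add: real_integrable_def less_top)

lemma nn_integral_less_top_if_bounded:
  fixes f h :: "'a \<Rightarrow> real"
  assumes "integrable M h" "AE x in M. f x \<le> h x"
  shows "(\<integral>\<^sup>+x. ennreal (f x) \<partial>M) < \<infinity>"
proof -
  have "(\<integral>\<^sup>+x. ennreal (f x) \<partial>M) \<le> (\<integral>\<^sup>+x. ennreal (h x) \<partial>M)"
    by (rule nn_integral_mono_AE, use assms(2) in eventually_elim) (rule ennreal_leI)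
  also have "\<dots> < \<infinity>"
    using assms(1) by (auto simp: real_integrable_def less_top)
  finally show ?thesis .
qed

lemma integrable_between:
  fixes f g h :: "'a \<Rightarrow> real"
  assumes "integrable M g" "integrable M h" "f \<in> borel_measurable M"
    and "AE x in M. g x \<le> f x" "AE x in M. f x \<le> h x"
  shows "integrable M f"
proof (rule integrable_if_parts_finite)
  show "(\<integral>\<^sup>+x. ennreal (f x) \<partial>M) < \<infinity>"
    by (rule nn_integral_less_top_if_bounded[OF assms(2,5)])
  show "(\<integral>\<^sup>+x. ennreal (- f x) \<partial>M) < \<infinity>"
    by (rule nn_integral_less_top_if_bounded[where h="\<lambda>x. - g x"]) (use assms in auto)
qed fact

lemma integrable_if_ext_integral_less_top:
  fixes f g :: "'a \<Rightarrow> real"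
  assumes "f \<in> borel_measurable M" "integrable M g" "AE x in M. g x \<le> f x"
    and "ext_integral M (\<lambda>x. ereal (f x)) < \<infinity>"
  shows "integrable M f"
proof (rule integrable_if_parts_finite)
  show "(\<integral>\<^sup>+x. ennreal (f x) \<partial>M) < \<infinity>"
    using nn_integral_less_top_if_ext_integral_less_top[OF assms(4)] by simp
  show "(\<integral>\<^sup>+x. ennreal (- f x) \<partial>M) < \<infinity>"
    by (rule nn_integral_less_top_if_bounded[where h="\<lambda>x. - g x"]) (use assms in auto)
qed fact

lemma integrable_if_ext_integral_greater_bot:
  fixes f h :: "'a \<Rightarrow> real"
  assumes "f \<in> borel_measurable M" "integrable M h" "AE x in M. f x \<le> h x"
    and "-\<infinity> < ext_integral M (\<lambda>x. ereal (f x))"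
  shows "integrable M f"
proof (rule integrable_if_parts_finite)
  show *: "(\<integral>\<^sup>+x. ennreal (f x) \<partial>M) < \<infinity>"
    by (rule nn_integral_less_top_if_bounded[OF assms(2,3)])
  have "ext_integral_defined M (\<lambda>x. ereal (f x))"
    using * by (auto simp: ext_integral_defined_def)
  from nn_integral_neg_less_top_if_ext_integral_greater_bot[OF assms(4) this]
  show "(\<integral>\<^sup>+x. ennreal (- f x) \<partial>M) < \<infinity>"
    by simp
qed fact

lemma measurable_ext_integral:
  assumes "sigma_finite_measure M" "case_prod f \<in> borel_measurable (N \<Otimes>\<^sub>M M)"
  shows "(\<lambda>x. ext_integral M (f x)) \<in> borel_measurable N"
proof -
  interpret sigma_finite_measure M by fact
  note assms(2)[measurable]
  show ?thesis
    unfolding ext_integral_def by measurable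
qed

section \<open>Scalar inequalities and extended logarithms\<close>

lemma eln_ereal: "0 < x \<Longrightarrow> eln (ereal x) = ereal (ln x)"
  by (simp add: eln_def)

lemma measurable_eln [measurable]: "eln \<in> borel_measurable borel"
  unfolding eln_def by measurable

lemma eln_ratio:
  assumes "0 < a" "0 \<le> b"
  shows "eln (ereal a / ereal b) = (if b = 0 then \<infinity> else ereal (ln a - ln b))"
  using assms by (auto simp: eln_def ln_div zero_ereal_def divide_le_0_iff)

text \<open>
  The pointwise form of the Donsker--Varadhan duality \<open>\<integral> w f - \<integral> w ln w \<le> ln \<integral> exp f\<close>, with
  \<open>g = exp f\<close>: if \<open>w\<close> has mass \<open>1\<close> and \<open>g\<close> is rescaled to mass \<open>1\<close>, then \<open>- w + g\<close> integrates to
  \<open>0\<close>. A pointwise inequality, unlike the dual one, also controls the integrability of \<open>w f\<close>.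
\<close>

lemma young_entropy:
  fixes w g :: real
  assumes "0 \<le> w" "0 \<le> g" "w \<noteq> 0 \<Longrightarrow> g \<noteq> 0"
  shows "w * ln g \<le> w * ln w - w + g"
proof (cases "w = 0")
  case False
  with assms have "0 < w" "0 < g" by auto
  then have "ln (g / w) \<le> g / w - 1"
    by (intro ln_le_minus_one) simp
  then have "w * ln (g / w) \<le> w * (g / w - 1)"
    using \<open>0 < w\<close> by (intro mult_left_mono) auto
  then show ?thesis
    using \<open>0 < w\<close> \<open>0 < g\<close> by (simp add: ln_div algebra_simps)
qed (use assms in simp)

lemma powr_le_affine:
  fixes t s :: real
  assumes "0 \<le> t" "0 < s" "s < 1"
  shows "t powr s \<le> s * t + (1 - s)"
proof (cases "t = 0")
  case False
  then show ?thesis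
    using Youngs_inequality_0[of s "1 - s" t 1] assms by simp
qed (use assms in simp)

lemma epowr_nonneg: "0 \<le> epowr x s"
  by (simp add: epowr_def)

lemma prob_density_integral:
  assumes "prob_density M w"
  shows "integrable M w" "(\<integral>x. w x \<partial>M) = 1"
proof -
  have w: "w \<in> borel_measurable M" "AE x in M. 0 \<le> w x" "(\<integral>\<^sup>+x. ennreal (w x) \<partial>M) = ennreal 1"
    using assms by (auto simp: prob_density_def)
  show "integrable M w"
    by (rule integrableI_nn_integral_finite[OF w])
  show "(\<integral>x. w x \<partial>M) = 1"
    by (simp add: integral_eq_nn_integral[OF w(1,2)] w(3))
qed

text \<open>
  The tangent \<open>w ln w \<ge> w - 1\<close> is an integrable lower bound.
\<close>

lemma integrable_entropy:
  assumes "prob_density M w" "prob_space M" "KL_prior M w < \<infinity>"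
  shows "integrable M (\<lambda>x. w x * ln (w x))"
proof -
  interpret prob_space M by fact
  have [measurable]: "w \<in> borel_measurable M"
    using assms(1) by (simp add: prob_density_def)
  show ?thesis
  proof (rule integrable_if_ext_integral_less_top[where g="\<lambda>x. w x - 1"])
    show "integrable M (\<lambda>x. w x - 1)"
      using prob_density_integral(1)[OF assms(1)] by simp
    show "AE x in M. w x - 1 \<le> w x * ln (w x)"
      using assms(1) young_entropy[of "w _" 1] by (intro AE_I2) (fastforce simp: prob_density_def)
  qed (use assms(3) in \<open>simp_all add: KL_prior_def\<close>)
qed

section \<open>The model and its affinity\<close>

locale density_model =
  fixes \<mu> :: "'a measure" and q :: "'a \<Rightarrow> real"
    and \<pi> :: "'t measure" and p :: "'t \<Rightarrow> 'a \<Rightarrow> real"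
    and n :: nat and \<rho> \<alpha> :: real
  assumes q_density: "prob_density \<mu> q"
    and prior: "prob_space \<pi>"
    and p_density: "\<And>\<theta>. \<theta> \<in> space \<pi> \<Longrightarrow> prob_density \<mu> (p \<theta>)"
    and p_measurable: "(\<lambda>(x, \<theta>). p \<theta> x) \<in> borel_measurable (\<mu> \<Otimes>\<^sub>M \<pi>)"
    and n_pos: "0 < n"
    and \<rho>_range: "0 < \<rho>" "\<rho> < 1"
    and \<alpha>_pos: "0 < \<alpha>"
begin

abbreviation truth :: "'a measure" where "truth \<equiv> law \<mu> q"

abbreviation samples :: "(nat \<Rightarrow> 'a) measure" where "samples \<equiv> sample_law \<mu> q n"

lemma sets_truth [simp, measurable_cong]: "sets truth = sets \<mu>"
  by (simp add: law_def)

lemma space_truth [simp]: "space truth = space \<mu>"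
  by (simp add: law_def)

lemma measurable_q [measurable]: "q \<in> borel_measurable \<mu>"
  using q_density by (simp add: prob_density_def)

lemma measurable_p [measurable (raw)]:
  assumes [measurable]: "f \<in> measurable N \<mu>" "g \<in> measurable N \<pi>"
  shows "(\<lambda>z. p (g z) (f z)) \<in> borel_measurable N"
proof -
  have "(\<lambda>z. (f z, g z)) \<in> measurable N (\<mu> \<Otimes>\<^sub>M \<pi>)"
    by measurable
  from measurable_compose[OF this p_measurable] show ?thesis
    by simp
qed

lemma measurable_sample_component:
  assumes "i < n"
  shows "(\<lambda>X. X i) \<in> measurable samples \<mu>" "(\<lambda>z. fst z i) \<in> measurable (samples \<Otimes>\<^sub>M \<pi>) \<mu>"
proof -
  have "(\<lambda>X. X i) \<in> measurable samples truth"
    unfolding sample_law_def using assms by (intro measurable_component_singleton) simp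
  then show *: "(\<lambda>X. X i) \<in> measurable samples \<mu>"
    by (simp cong: measurable_cong_sets)
  show "(\<lambda>z. fst z i) \<in> measurable (samples \<Otimes>\<^sub>M \<pi>) \<mu>"
    by (rule measurable_compose[OF measurable_fst *])
qed

lemma q_nonneg: "x \<in> space \<mu> \<Longrightarrow> 0 \<le> q x"
  using q_density by (simp add: prob_density_def)

lemma p_nonneg: "\<theta> \<in> space \<pi> \<Longrightarrow> x \<in> space \<mu> \<Longrightarrow> 0 \<le> p \<theta> x"
  using p_density[of \<theta>] by (simp add: prob_density_def)

lemma sample_in_space: "X \<in> space samples \<Longrightarrow> i < n \<Longrightarrow> X i \<in> space \<mu>"
  by (auto simp: sample_law_def space_PiM)

sublocale truth: prob_space truth
  using q_density by (intro prob_spaceI) (simp add: law_def emeasure_density prob_density_def cong: nn_integral_cong)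

sublocale prior: prob_space \<pi>
  by (rule prior)

sublocale product_truth: product_prob_space "\<lambda>_. truth" "{..<n}"
  by unfold_locales

sublocale samples: prob_space samples
  unfolding sample_law_def by (intro prob_space_PiM truth.prob_space_axioms)

sublocale truth_prior: pair_sigma_finite truth \<pi>
  by unfold_locales

sublocale samples_prior: pair_sigma_finite samples \<pi>
  by unfold_locales

lemma AE_truth_q_pos: "AE x in truth. 0 < q x"
  unfolding law_def by (subst AE_density) (auto intro!: AE_I2 simp: ennreal_neg less_le q_nonneg)

lemma AE_samples_component:
  assumes "AE x in truth. Q x"
  shows "AE X in samples. \<forall>i<n. Q (X i)"
proof -
  have "AE X in samples. \<forall>i\<in>{..<n}. Q (X i)"
    unfolding sample_law_def
    by (intro AE_finite_allI AE_PiM_component truth.prob_space_axioms assms) auto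
  then show ?thesis
    by (simp add: Ball_def)
qed

text \<open>
  The integral may fall short of \<open>1\<close>: the mass that \<open>p \<theta>\<close> puts on \<open>{q = 0}\<close> is lost.
\<close>

lemma nn_integral_ratio_le_1:
  assumes "\<theta> \<in> space \<pi>"
  shows "(\<integral>\<^sup>+x. ennreal (p \<theta> x / q x) \<partial>truth) \<le> 1"
proof -
  have [measurable]: "p \<theta> \<in> borel_measurable \<mu>"
    using assms by measurable
  have "(\<integral>\<^sup>+x. ennreal (p \<theta> x / q x) \<partial>truth) = (\<integral>\<^sup>+x. ennreal (q x) * ennreal (p \<theta> x / q x) \<partial>\<mu>)"
    unfolding law_def by (rule nn_integral_density) measurable
  also have "\<dots> \<le> (\<integral>\<^sup>+x. ennreal (p \<theta> x) \<partial>\<mu>)"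
    by (intro nn_integral_mono) (auto simp: ennreal_mult''[symmetric] q_nonneg p_nonneg[OF assms])
  finally show ?thesis
    using p_density[OF assms] by (simp add: prob_density_def)
qed

definition affinity :: "'t \<Rightarrow> real" where
  "affinity \<theta> = rho_affinity \<mu> \<rho> q (p \<theta>)"

lemma integrable_ratio:
  assumes "\<theta> \<in> space \<pi>"
  shows "integrable truth (\<lambda>x. p \<theta> x / q x)" "(\<integral>x. p \<theta> x / q x \<partial>truth) \<le> 1"
proof -
  have nn: "AE x in truth. 0 \<le> p \<theta> x / q x"
    by (auto simp: q_nonneg p_nonneg[OF assms])
  have [measurable]: "p \<theta> \<in> borel_measurable \<mu>"
    using assms by measurable
  have meas: "(\<lambda>x. p \<theta> x / q x) \<in> borel_measurable truth"
    by measurable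
  have "(\<integral>\<^sup>+x. ennreal (p \<theta> x / q x) \<partial>truth) < \<infinity>"
    using nn_integral_ratio_le_1[OF assms] by (rule order_le_less_trans) simp
  then show int: "integrable truth (\<lambda>x. p \<theta> x / q x)"
    by (intro integrableI_nonneg meas nn)
  show "(\<integral>x. p \<theta> x / q x \<partial>truth) \<le> 1"
    using nn_integral_ratio_le_1[OF assms] nn_integral_eq_integral[OF int nn] by simp
qed

lemma integrable_ratio_powr:
  assumes "\<theta> \<in> space \<pi>"
  shows "integrable truth (\<lambda>x. (p \<theta> x / q x) powr \<rho>)"
proof (rule integrable_between)
  have [measurable]: "p \<theta> \<in> borel_measurable \<mu>"
    using assms by measurable
  show "(\<lambda>x. (p \<theta> x / q x) powr \<rho>) \<in> borel_measurable truth"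
    by measurable
  show "integrable truth (\<lambda>x. 0 :: real)"
    by simp
  show "integrable truth (\<lambda>x. \<rho> * (p \<theta> x / q x) + (1 - \<rho>))"
    using integrable_ratio(1)[OF assms]
    by (intro Bochner_Integration.integrable_add integrable_mult_right truth.integrable_const)
  show "AE x in truth. (p \<theta> x / q x) powr \<rho> \<le> \<rho> * (p \<theta> x / q x) + (1 - \<rho>)"
    using \<rho>_range by (intro AE_I2 powr_le_affine) (auto simp: q_nonneg p_nonneg[OF assms])
qed simp

lemma affinity_nonneg: "0 \<le> affinity \<theta>"
  by (simp add: affinity_def rho_affinity_def)

lemma affinity_le_1:
  assumes "\<theta> \<in> space \<pi>"
  shows "affinity \<theta> \<le> 1"
proof -
  have "affinity \<theta> \<le> (\<integral>x. \<rho> * (p \<theta> x / q x) + (1 - \<rho>) \<partial>truth)"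
    unfolding affinity_def rho_affinity_def
  proof (intro integral_mono integrable_ratio_powr assms powr_le_affine)
    show "integrable truth (\<lambda>x. \<rho> * (p \<theta> x / q x) + (1 - \<rho>))"
      using integrable_ratio(1)[OF assms]
      by (intro Bochner_Integration.integrable_add integrable_mult_right truth.integrable_const)
  qed (use \<rho>_range in \<open>auto simp: q_nonneg p_nonneg[OF assms]\<close>)
  also have "\<dots> = \<rho> * (\<integral>x. p \<theta> x / q x \<partial>truth) + (1 - \<rho>)"
    using integrable_ratio(1)[OF assms] truth.prob_space
    by (subst Bochner_Integration.integral_add) (auto intro!: integrable_mult_right simp del: times_divide_eq_right)
  also have "\<dots> \<le> 1"
    using mult_left_mono[OF integrable_ratio(2)[OF assms], of \<rho>] \<rho>_range by simp
  finally show ?thesis .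
qed

lemma measurable_affinity [measurable]: "affinity \<in> borel_measurable \<pi>"
  unfolding affinity_def[abs_def] rho_affinity_def
  by (rule truth.borel_measurable_lebesgue_integral) measurable

lemma D_Re_eq:
  "D_Re \<mu> \<rho> q (p \<theta>) =
    (if affinity \<theta> = 0 then \<infinity> else ereal (- ln (affinity \<theta>) / (\<rho> * (1 - \<rho>))))"
  using \<rho>_range affinity_nonneg[of \<theta>]
  by (auto simp: D_Re_def affinity_def[symmetric] eln_def zero_ereal_def)

lemma D_rho_le_D_Re:
  assumes "\<theta> \<in> space \<pi>"
  shows "ereal (D_rho \<mu> \<rho> q (p \<theta>)) \<le> D_Re \<mu> \<rho> q (p \<theta>)"
proof (cases "affinity \<theta> = 0")
  case False
  then have "0 < affinity \<theta>"
    using affinity_nonneg[of \<theta>] by simp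
  from ln_le_minus_one[OF this]
  have "(1 - affinity \<theta>) / (\<rho> * (1 - \<rho>)) \<le> - ln (affinity \<theta>) / (\<rho> * (1 - \<rho>))"
    using \<rho>_range by (intro divide_right_mono) auto
  moreover have "D_rho \<mu> \<rho> q (p \<theta>) = (1 - affinity \<theta>) / (\<rho> * (1 - \<rho>))"
    using integrable_ratio_powr[OF assms] truth.prob_space
    by (simp add: D_rho_def affinity_def rho_affinity_def)
  ultimately show ?thesis
    using False by (simp add: D_Re_eq)
qed (simp add: D_Re_eq)

text \<open>
  Also for \<open>affinity \<theta> = 0\<close>, where \<open>D_Re = \<infinity>\<close>: according to the sign of \<open>1 - \<alpha>\<close>, both sides are
  \<open>0\<close>, \<open>1\<close> (from \<open>0 * \<infinity> = 0\<close>) or \<open>\<infinity>\<close>.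
\<close>

lemma epowr_affinity_eq_eexp:
  "epowr (affinity \<theta>) ((1 - \<alpha>) * real n) =
    eexp (ereal (- \<rho> * (1 - \<rho>) * (1 - \<alpha>) * real n) * D_Re \<mu> \<rho> q (p \<theta>))"
proof (cases "affinity \<theta> = 0")
  case True
  have "0 < \<rho> * (1 - \<rho>) * real n"
    using \<rho>_range n_pos by simp
  then have "- \<rho> * (1 - \<rho>) * (1 - \<alpha>) * real n < 0 \<longleftrightarrow> 0 < 1 - \<alpha>"
      "0 < - \<rho> * (1 - \<rho>) * (1 - \<alpha>) * real n \<longleftrightarrow> 1 - \<alpha> < 0"
      "- \<rho> * (1 - \<rho>) * (1 - \<alpha>) * real n = 0 \<longleftrightarrow> 1 - \<alpha> = 0"
    using \<rho>_range n_pos by (auto simp: mult_less_0_iff zero_less_mult_iff)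
  then show ?thesis
    using True n_pos
    by (cases "\<alpha> < 1"; cases "\<alpha> = 1")
       (auto simp: D_Re_eq epowr_def eexp_def ereal_mult_infty mult_less_0_iff zero_ereal_def)
next
  case False
  have "- \<rho> * (1 - \<rho>) * (1 - \<alpha>) * real n * (- ln (affinity \<theta>) / (\<rho> * (1 - \<rho>)))
      = (1 - \<alpha>) * real n * ln (affinity \<theta>)"
    using \<rho>_range by (simp add: field_simps)
  then show ?thesis
    using False by (simp add: D_Re_eq epowr_def eexp_def powr_def)
qed

section \<open>Log-likelihood ratios and the tilted likelihood\<close>

text \<open>
  A real-valued version of the empirical log-likelihood ratio; because \<open>ln 0 = 0\<close>, it agrees with the
  extended one only where all the densities involved are positive.
\<close>

definition log_ratio :: "(nat \<Rightarrow> 'a) \<Rightarrow> 't \<Rightarrow> real" where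
  "log_ratio X \<theta> = (\<Sum>i<n. ln (q (X i)) - ln (p \<theta> (X i)))"

text \<open>
  The exponential of \<open>- \<rho> log_ratio - \<alpha> n ln (affinity)\<close>, as long as all the densities and the
  affinity are positive. It is \<open>0\<close> where the affinity vanishes,
  since \<open>0 powr s = 0\<close> for every \<open>s\<close>.
\<close>

definition tilted :: "(nat \<Rightarrow> 'a) \<Rightarrow> 't \<Rightarrow> real" where
  "tilted X \<theta> = (\<Prod>i<n. (p \<theta> (X i) / q (X i)) powr \<rho>) * affinity \<theta> powr (- \<alpha> * real n)"

lemma tilted_nonneg: "0 \<le> tilted X \<theta>"
  by (simp add: tilted_def prod_nonneg)

lemma measurable_q_sample: "i < n \<Longrightarrow> (\<lambda>z. q (fst z i)) \<in> borel_measurable (samples \<Otimes>\<^sub>M \<pi>)"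
  by (rule measurable_compose[OF measurable_sample_component(2) measurable_q])

lemma measurable_p_sample:
  "i < n \<Longrightarrow> (\<lambda>z. p (snd z) (fst z i)) \<in> borel_measurable (samples \<Otimes>\<^sub>M \<pi>)"
  by (rule measurable_p[OF measurable_sample_component(2) measurable_snd])

lemma measurable_log_ratio:
  "(\<lambda>z. log_ratio (fst z) (snd z)) \<in> borel_measurable (samples \<Otimes>\<^sub>M \<pi>)"
  unfolding log_ratio_def
  by (intro borel_measurable_sum borel_measurable_diff borel_measurable_ln measurable_q_sample measurable_p_sample)
     auto

lemma measurable_tilted:
  "(\<lambda>z. tilted (fst z) (snd z)) \<in> borel_measurable (samples \<Otimes>\<^sub>M \<pi>)"
proof -
  have "(\<lambda>z. affinity (snd z) powr (- \<alpha> * real n)) \<in> borel_measurable (samples \<Otimes>\<^sub>M \<pi>)"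
    by measurable
  moreover have "(\<lambda>z. \<Prod>i<n. (p (snd z) (fst z i) / q (fst z i)) powr \<rho>) \<in> borel_measurable (samples \<Otimes>\<^sub>M \<pi>)"
    by (intro borel_measurable_prod powr_real_measurable borel_measurable_divide
        measurable_q_sample measurable_p_sample) auto
  ultimately show ?thesis
    unfolding tilted_def by (rule borel_measurable_times[rotated])
qed

lemma measurable_p_at:
  assumes "X \<in> space samples" "i < n"
  shows "(\<lambda>\<theta>. p \<theta> (X i)) \<in> borel_measurable \<pi>"
  using sample_in_space[OF assms] by measurable

lemma measurable_log_ratio_at:
  assumes "X \<in> space samples"
  shows "log_ratio X \<in> borel_measurable \<pi>"
  using measurable_compose[OF measurable_Pair1'[OF assms] measurable_log_ratio] by simp

lemma measurable_tilted_at: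
  assumes "X \<in> space samples"
  shows "tilted X \<in> borel_measurable \<pi>"
  using measurable_compose[OF measurable_Pair1'[OF assms] measurable_tilted] by simp

text \<open>
  Independence turns the expectation of the product of likelihood ratios into \<open>affinity \<theta> ^ n\<close>. The
  inequality is strict only if the affinity is \<open>0\<close> and \<open>\<alpha> \<ge> 1\<close>.
\<close>

lemma nn_integral_tilted_le:
  assumes "\<theta> \<in> space \<pi>"
  shows "(\<integral>\<^sup>+X. ennreal (tilted X \<theta>) \<partial>samples) \<le> e2ennreal (epowr (affinity \<theta>) ((1 - \<alpha>) * real n))"
proof (cases "affinity \<theta> = 0")
  case False
  then have A: "0 < affinity \<theta>"
    using affinity_nonneg[of \<theta>] by simp
  let ?f = "\<lambda>x. (p \<theta> x / q x) powr \<rho>"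
  have [measurable]: "p \<theta> \<in> borel_measurable \<mu>"
    using p_density[OF assms] by (simp add: prob_density_def)
  have f: "(\<lambda>x. ennreal (?f x)) \<in> borel_measurable truth"
    by measurable
  have "(\<integral>\<^sup>+x. ennreal (?f x) \<partial>truth) = ennreal (affinity \<theta>)"
    using integrable_ratio_powr[OF assms]
    by (simp add: nn_integral_eq_integral affinity_def rho_affinity_def)
  then have prod: "(\<integral>\<^sup>+X. (\<Prod>i<n. ennreal (?f (X i))) \<partial>samples) = ennreal (affinity \<theta>) ^ n"
    unfolding sample_law_def
    using product_truth.product_nn_integral_prod[of "{..<n}" "\<lambda>_ x. ennreal (?f x)"] f by simp
  have meas: "(\<lambda>X. \<Prod>i<n. ennreal (?f (X i))) \<in> borel_measurable samples"
    by (intro borel_measurable_prod_ennreal measurable_compose[OF measurable_sample_component(1)])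
       (use f in auto)
  have "(\<integral>\<^sup>+X. ennreal (tilted X \<theta>) \<partial>samples)
      = (\<integral>\<^sup>+X. (\<Prod>i<n. ennreal (?f (X i))) * ennreal (affinity \<theta> powr (- \<alpha> * real n)) \<partial>samples)"
    by (simp add: tilted_def ennreal_mult prod_nonneg prod_ennreal)
  also have "\<dots> = ennreal (affinity \<theta>) ^ n * ennreal (affinity \<theta> powr (- \<alpha> * real n))"
    by (simp only: nn_integral_multc[OF meas] prod)
  also have "\<dots> = ennreal (affinity \<theta> powr real n * affinity \<theta> powr (- \<alpha> * real n))"
    using A by (simp add: ennreal_power ennreal_mult powr_realpow)
  also have "\<dots> = ennreal (affinity \<theta> powr ((1 - \<alpha>) * real n))"
    by (simp add: powr_add[symmetric] algebra_simps)
  finally show ?thesis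
    using False by (simp add: epowr_def)
qed (simp add: tilted_def)

text \<open>
  If the affinity is \<open>0\<close>, then \<open>p \<theta>\<close> and \<open>q\<close> are mutually singular. For each such \<open>\<theta>\<close> this shows at
  almost every \<open>x\<close>; Fubini exchanges the quantifiers, so that a single observation reveals it for
  almost every \<open>\<theta>\<close>.
\<close>

lemma AE_affinity_zero:
  "AE x in truth. AE \<theta> in \<pi>. affinity \<theta> = 0 \<longrightarrow> (p \<theta> x / q x) powr \<rho> = 0"
proof (rule truth_prior.AE_commute
    [where P = "\<lambda>x \<theta>. affinity \<theta> = 0 \<longrightarrow> (p \<theta> x / q x) powr \<rho> = 0", THEN iffD2])
  show "{z \<in> space (truth \<Otimes>\<^sub>M \<pi>). affinity (snd z) = 0 \<longrightarrow> (p (snd z) (fst z) / q (fst z)) powr \<rho> = 0}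
      \<in> sets (truth \<Otimes>\<^sub>M \<pi>)"
    by measurable
  show "AE \<theta> in \<pi>. AE x in truth. affinity \<theta> = 0 \<longrightarrow> (p \<theta> x / q x) powr \<rho> = 0"
  proof (rule AE_I2)
    fix \<theta> assume \<theta>: "\<theta> \<in> space \<pi>"
    show "AE x in truth. affinity \<theta> = 0 \<longrightarrow> (p \<theta> x / q x) powr \<rho> = 0"
    proof (cases "affinity \<theta> = 0")
      case True
      then show ?thesis
        using integral_nonneg_eq_0_iff_AE[OF integrable_ratio_powr[OF \<theta>]]
        by (simp add: affinity_def rho_affinity_def)
    qed simp
  qed
qed

section \<open>Weights of finite empirical risk\<close>

text \<open>
  The conditions under which the extended-real risks and objectives of \<open>w\<close> at the sample \<open>X\<close> are
  given by the real integrals of \<open>log_ratio\<close>.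
\<close>

definition regular_at :: "(nat \<Rightarrow> 'a) \<Rightarrow> ('t \<Rightarrow> real) \<Rightarrow> bool" where
  "regular_at X w \<longleftrightarrow>
     (\<forall>i<n. 0 < q (X i)) \<and> (AE \<theta> in \<pi>. w \<theta> \<noteq> 0 \<longrightarrow> (\<forall>i<n. 0 < p \<theta> (X i))) \<and>
     integrable \<pi> (\<lambda>\<theta>. w \<theta> * log_ratio X \<theta>) \<and> integrable \<pi> (\<lambda>\<theta>. w \<theta> * ln (w \<theta>))"

lemma R_hat_regular:
  assumes "regular_at X w"
  shows "R_hat q p \<pi> n l X w =
    ereal (((\<integral>\<theta>. w \<theta> * log_ratio X \<theta> \<partial>\<pi>) + l * (\<integral>\<theta>. w \<theta> * ln (w \<theta>) \<partial>\<pi>)) / real n)"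
proof -
  have q: "\<forall>i<n. 0 < q (X i)" and
    p: "AE \<theta> in \<pi>. w \<theta> \<noteq> 0 \<longrightarrow> (\<forall>i<n. 0 < p \<theta> (X i))" and
    int: "integrable \<pi> (\<lambda>\<theta>. w \<theta> * log_ratio X \<theta>)" "integrable \<pi> (\<lambda>\<theta>. w \<theta> * ln (w \<theta>))"
    using assms by (auto simp: regular_at_def)
  have "AE \<theta> in \<pi>. emp_log_ratio q p n X w \<theta> = ereal (w \<theta> * log_ratio X \<theta>)"
    using p
  proof eventually_elim
    case (elim \<theta>)
    show ?case
    proof (cases "w \<theta> = 0")
      case False
      then have "(\<Sum>i<n. eln (ereal (q (X i)) / ereal (p \<theta> (X i)))) = (\<Sum>i<n. ereal (ln (q (X i)) - ln (p \<theta> (X i))))"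
        using elim q by (intro sum.cong refl, subst eln_ratio) (auto simp: less_le)
      then show ?thesis
        by (simp add: emp_log_ratio_def log_ratio_def)
    qed (simp add: emp_log_ratio_def zero_ereal_def[symmetric])
  qed
  then have "ext_integral \<pi> (emp_log_ratio q p n X w) = ereal (\<integral>\<theta>. w \<theta> * log_ratio X \<theta> \<partial>\<pi>)"
    using ext_integral_cong_AE ext_integral_ereal[OF int(1)] by metis
  then show ?thesis
    using ext_integral_ereal[OF int(2)] by (simp add: R_hat_def KL_prior_def add_divide_distrib)
qed

lemma log_lik_eq:
  assumes "\<forall>i<n. 0 < p \<theta> (X i)"
  shows "log_lik p n X w \<theta> = ereal (w \<theta> * (\<Sum>i<n. ln (p \<theta> (X i))))"
proof -
  have "(\<Sum>i<n. eln (ereal (p \<theta> (X i)))) = (\<Sum>i<n. ereal (ln (p \<theta> (X i))))"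
    using assms by (intro sum.cong refl eln_ereal) auto
  then show ?thesis
    by (simp add: log_lik_def)
qed

lemma log_lik_eq_minus_infty:
  assumes "i < n" "p \<theta> (X i) \<le> 0" "0 < w \<theta>"
  shows "log_lik p n X w \<theta> = - \<infinity>"
proof -
  have "(\<Sum>i<n. eln (ereal (p \<theta> (X i)))) = - \<infinity>"
  proof -
    have "eln (ereal x) \<noteq> \<infinity>" for x
      by (simp add: eln_def)
    moreover have "eln (ereal (p \<theta> (X i))) = - \<infinity>"
      using assms by (simp add: eln_def zero_ereal_def)
    ultimately show ?thesis
      using sum.remove[of "{..<n}" i "\<lambda>j. eln (ereal (p \<theta> (X j)))"] \<open>i < n\<close>
        sum_Pinfty[of "\<lambda>j. eln (ereal (p \<theta> (X j)))" "{..<n} - {i}"] by auto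
  qed
  then show ?thesis
    using \<open>0 < w \<theta>\<close> by (simp add: log_lik_def)
qed

lemma log_ratio_eq:
  "log_ratio X \<theta> = (\<Sum>i<n. ln (q (X i))) - (\<Sum>i<n. ln (p \<theta> (X i)))"
  by (simp add: log_ratio_def sum_subtractf)

lemma icm_objective_regular:
  assumes "prob_density \<pi> w" "regular_at X w"
  shows "icm_objective p \<pi> n l X w =
    ereal ((\<integral>\<theta>. w \<theta> * log_ratio X \<theta> \<partial>\<pi>) - (\<Sum>i<n. ln (q (X i))) + l * (\<integral>\<theta>. w \<theta> * ln (w \<theta>) \<partial>\<pi>))"
proof -
  let ?C = "\<Sum>i<n. ln (q (X i))"
  have p: "AE \<theta> in \<pi>. w \<theta> \<noteq> 0 \<longrightarrow> (\<forall>i<n. 0 < p \<theta> (X i))" and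
    int: "integrable \<pi> (\<lambda>\<theta>. w \<theta> * log_ratio X \<theta>)" "integrable \<pi> (\<lambda>\<theta>. w \<theta> * ln (w \<theta>))"
    using assms by (auto simp: regular_at_def)
  note w = prob_density_integral[OF assms(1)]
  have "AE \<theta> in \<pi>. log_lik p n X w \<theta> = ereal (?C * w \<theta> - w \<theta> * log_ratio X \<theta>)"
    using p
  proof eventually_elim
    case (elim \<theta>)
    show ?case
    proof (cases "w \<theta> = 0")
      case False
      then show ?thesis
        using elim by (simp add: log_lik_eq log_ratio_eq algebra_simps)
    qed (simp add: log_lik_def zero_ereal_def[symmetric])
  qed
  then have "ext_integral \<pi> (log_lik p n X w) = ereal (\<integral>\<theta>. ?C * w \<theta> - w \<theta> * log_ratio X \<theta> \<partial>\<pi>)"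
    using int(1) w by (subst ext_integral_ereal[symmetric]) (auto intro: ext_integral_cong_AE)
  also have "(\<integral>\<theta>. ?C * w \<theta> - w \<theta> * log_ratio X \<theta> \<partial>\<pi>) = ?C - (\<integral>\<theta>. w \<theta> * log_ratio X \<theta> \<partial>\<pi>)"
    using int(1) w by simp
  finally show ?thesis
    using ext_integral_ereal[OF int(2)] by (simp add: icm_objective_def KL_prior_def)
qed

text \<open>
  Finiteness of the objective bounds the negative part of \<open>w * log_lik\<close>, whence \<open>w\<close> vanishes wherever
  some observation has density \<open>0\<close>. On the rest, \<open>ln (tilted X \<theta>)\<close> is the exponent
  \<open>- \<rho> log_ratio - \<alpha> n ln (affinity)\<close>, and \<open>young_entropy\<close> bounds \<open>w\<close> times it from above. As
  \<open>- ln (affinity) \<ge> 0\<close>, this bounds \<open>w * log_ratio\<close> from below by an integrable function, which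
  settles integrability; the last claim is the integrated inequality. The constant \<open>K\<close> will be the
  total mass of \<open>tilted\<close> over sample and prior.
\<close>

lemma entropy_bound:
  assumes X: "X \<in> space samples" and q: "\<forall>i<n. 0 < q (X i)"
    and w: "prob_density \<pi> w" and l: "0 < l"
    and defd: "icm_objective_defined p \<pi> n l X w"
    and obj: "icm_objective p \<pi> n l X w < \<infinity>"
    and A0: "AE \<theta> in \<pi>. affinity \<theta> = 0 \<longrightarrow> (\<exists>i<n. p \<theta> (X i) = 0)"
    and tilted: "integrable \<pi> (tilted X)"
  shows "regular_at X w"
    and "AE \<theta> in \<pi>. w \<theta> \<noteq> 0 \<longrightarrow> 0 < affinity \<theta>"
    and "integrable \<pi> (\<lambda>\<theta>. w \<theta> * - ln (affinity \<theta>))"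
    and "0 < K \<Longrightarrow> \<alpha> * real n * (\<integral>\<theta>. w \<theta> * - ln (affinity \<theta>) \<partial>\<pi>)
      \<le> \<rho> * (\<integral>\<theta>. w \<theta> * log_ratio X \<theta> \<partial>\<pi>) + (\<integral>\<theta>. w \<theta> * ln (w \<theta>) \<partial>\<pi>)
        + (ln K - 1) + (\<integral>\<theta>. tilted X \<theta> \<partial>\<pi>) / K"
proof -
  let ?C = "\<Sum>i<n. ln (q (X i))" and ?L = "\<lambda>\<theta>. \<Sum>i<n. ln (p \<theta> (X i))"
  let ?a = "\<lambda>\<theta>. - ln (affinity \<theta>)"
  note w_int = prob_density_integral[OF w]
  have w_nonneg: "\<And>\<theta>. \<theta> \<in> space \<pi> \<Longrightarrow> 0 \<le> w \<theta>" and [measurable]: "w \<in> borel_measurable \<pi>"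
    using w by (auto simp: prob_density_def)
  note measurable_tilted_at[OF X, measurable] measurable_log_ratio_at[OF X, measurable]
  have meas_L [measurable]: "?L \<in> borel_measurable \<pi>"
    by (intro borel_measurable_sum borel_measurable_ln measurable_p_at X) auto
  have a_nonneg: "\<theta> \<in> space \<pi> \<Longrightarrow> 0 \<le> ?a \<theta>" for \<theta>
    using affinity_nonneg[of \<theta>] affinity_le_1[of \<theta>] by (cases "affinity \<theta> = 0") (auto simp: ln_le_zero_iff)

  have lik: "ext_integral \<pi> (log_lik p n X w) > -\<infinity>" and KL: "KL_prior \<pi> w < \<infinity>"
    using obj l by (auto simp: icm_objective_def ereal_mult_infty)
  have ent: "integrable \<pi> (\<lambda>\<theta>. w \<theta> * ln (w \<theta>))"
    by (rule integrable_entropy[OF w prior KL])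
  have N: "(\<integral>\<^sup>+\<theta>. e2ennreal (- log_lik p n X w \<theta>) \<partial>\<pi>) < \<infinity>"
    using nn_integral_neg_less_top_if_ext_integral_greater_bot[OF lik] defd
    by (simp add: icm_objective_defined_def)
  have "(\<lambda>\<theta>. \<Sum>i<n. eln (ereal (p \<theta> (X i)))) \<in> borel_measurable \<pi>"
    by (intro borel_measurable_ereal_sum measurable_compose[OF _ measurable_eln]
        borel_measurable_ereal measurable_p_at X) auto
  then have [measurable]: "log_lik p n X w \<in> borel_measurable \<pi>"
    unfolding log_lik_def by measurable
  have "AE \<theta> in \<pi>. e2ennreal (- log_lik p n X w \<theta>) \<noteq> \<infinity>"
    by (rule nn_integral_PInf_AE) (use N in auto)
  then have pos: "AE \<theta> in \<pi>. w \<theta> \<noteq> 0 \<longrightarrow> (\<forall>i<n. 0 < p \<theta> (X i))"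
    using AE_space
  proof eventually_elim
    case (elim \<theta>)
    show ?case
    proof (intro impI allI, rule ccontr)
      fix i assume "w \<theta> \<noteq> 0" "i < n" "\<not> 0 < p \<theta> (X i)"
      then have "log_lik p n X w \<theta> = -\<infinity>"
        using w_nonneg[OF elim(2)] by (intro log_lik_eq_minus_infty[of i]) auto
      then show False
        using elim(1) by (simp add: e2ennreal_infty)
    qed
  qed
  show A_pos: "AE \<theta> in \<pi>. w \<theta> \<noteq> 0 \<longrightarrow> 0 < affinity \<theta>"
    using pos A0 by eventually_elim (use affinity_nonneg in \<open>fastforce simp: less_le\<close>)

  have young: "AE \<theta> in \<pi>. \<alpha> * real n * (w \<theta> * ?a \<theta>)
      \<le> \<rho> * (w \<theta> * log_ratio X \<theta>) + w \<theta> * ln (w \<theta>) + (ln K - 1) * w \<theta> + tilted X \<theta> / K" if K: "0 < K" for K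
    using pos A_pos AE_space
  proof eventually_elim
    case (elim \<theta>)
    show ?case
    proof (cases "w \<theta> = 0")
      case True
      then show ?thesis
        using K tilted_nonneg[of X \<theta>] by simp
    next
      case False
      have A: "0 < affinity \<theta>" and r: "\<And>i. i < n \<Longrightarrow> 0 < p \<theta> (X i) / q (X i)"
        and nz: "\<And>i. i < n \<Longrightarrow> p \<theta> (X i) \<noteq> 0" "\<And>i. i < n \<Longrightarrow> q (X i) \<noteq> 0"
        using False elim q by (auto simp: less_le)
      have t: "0 < tilted X \<theta>"
        unfolding tilted_def using A by (intro mult_pos_pos prod_pos) (auto dest: nz)
      have f_pos: "0 < (p \<theta> (X i) / q (X i)) powr \<rho>" if "i < n" for i
        using nz[OF that] by simp
      have "ln (tilted X \<theta>) = ln (\<Prod>i<n. (p \<theta> (X i) / q (X i)) powr \<rho>) + ln (affinity \<theta> powr (- \<alpha> * real n))"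
        unfolding tilted_def using A f_pos by (intro ln_mult_pos prod_pos) auto
      also have "ln (\<Prod>i<n. (p \<theta> (X i) / q (X i)) powr \<rho>) = (\<Sum>i<n. ln ((p \<theta> (X i) / q (X i)) powr \<rho>))"
        by (rule ln_prod) (use f_pos in fastforce)+
      also have "(\<Sum>i<n. ln ((p \<theta> (X i) / q (X i)) powr \<rho>)) = - \<rho> * log_ratio X \<theta>"
        unfolding log_ratio_def sum_distrib_left
        using False elim q by (intro sum.cong refl) (auto simp: ln_powr ln_div algebra_simps)
      also have "ln (affinity \<theta> powr (- \<alpha> * real n)) = \<alpha> * real n * ?a \<theta>"
        using A by (simp add: ln_powr)
      finally have ln_t: "ln (tilted X \<theta>) = - \<rho> * log_ratio X \<theta> + \<alpha> * real n * ?a \<theta>" .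
      have "w \<theta> * ln (tilted X \<theta> / K) \<le> w \<theta> * ln (w \<theta>) - w \<theta> + tilted X \<theta> / K"
        using t K w_nonneg elim by (intro young_entropy) auto
      then show ?thesis
        using t K by (simp add: ln_div ln_t algebra_simps)
    qed
  qed

  \<comment> \<open>The entropy inequality bounds the weighted log-likelihood from above by an integrable function;
    its negative part has finite integral because the objective is finite.\<close>
  have L_int: "integrable \<pi> (\<lambda>\<theta>. w \<theta> * ?L \<theta>)"
  proof (rule integrable_if_parts_finite)
    let ?h = "\<lambda>\<theta>. ?C * w \<theta> + (w \<theta> * ln (w \<theta>) - w \<theta> + tilted X \<theta>) / \<rho>"
    show "(\<integral>\<^sup>+\<theta>. ennreal (w \<theta> * ?L \<theta>) \<partial>\<pi>) < \<infinity>"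
    proof (rule nn_integral_less_top_if_bounded[where h = ?h])
      show "integrable \<pi> ?h"
        using w_int ent tilted by simp
      show "AE \<theta> in \<pi>. w \<theta> * ?L \<theta> \<le> ?h \<theta>"
        using young[OF zero_less_one] AE_space
      proof eventually_elim
        case (elim \<theta>)
        have "0 \<le> \<alpha> * real n * (w \<theta> * ?a \<theta>)"
          using \<alpha>_pos w_nonneg a_nonneg elim(2) by (intro mult_nonneg_nonneg) auto
        then have "- (\<rho> * (w \<theta> * log_ratio X \<theta>)) \<le> w \<theta> * ln (w \<theta>) - w \<theta> + tilted X \<theta>"
          using elim(1) by simp
        then have "- (w \<theta> * log_ratio X \<theta>) \<le> (w \<theta> * ln (w \<theta>) - w \<theta> + tilted X \<theta>) / \<rho>"
          using \<rho>_range(1) by (simp add: field_simps)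
        then show ?case
          by (simp add: log_ratio_eq algebra_simps)
      qed
    qed
    have "(\<integral>\<^sup>+\<theta>. ennreal (- (w \<theta> * ?L \<theta>)) \<partial>\<pi>) = (\<integral>\<^sup>+\<theta>. e2ennreal (- log_lik p n X w \<theta>) \<partial>\<pi>)"
    proof (rule nn_integral_cong_AE, use pos in eventually_elim)
      fix \<theta> assume "w \<theta> \<noteq> 0 \<longrightarrow> (\<forall>i<n. 0 < p \<theta> (X i))"
      then show "ennreal (- (w \<theta> * ?L \<theta>)) = e2ennreal (- log_lik p n X w \<theta>)"
        by (cases "w \<theta> = 0") (auto simp: log_lik_eq, auto simp: log_lik_def zero_ereal_def[symmetric] e2ennreal_neg)
    qed
    then show "(\<integral>\<^sup>+\<theta>. ennreal (- (w \<theta> * ?L \<theta>)) \<partial>\<pi>) < \<infinity>"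
      using N by simp
  qed measurable
  have lr_int: "integrable \<pi> (\<lambda>\<theta>. w \<theta> * log_ratio X \<theta>)"
  proof -
    have "integrable \<pi> (\<lambda>\<theta>. ?C * w \<theta> - w \<theta> * ?L \<theta>)"
      using w_int L_int by simp
    then show ?thesis
      by (simp add: log_ratio_eq algebra_simps)
  qed
  then show "regular_at X w"
    using q pos ent by (simp add: regular_at_def)

  show wa_int: "integrable \<pi> (\<lambda>\<theta>. w \<theta> * ?a \<theta>)"
  proof (rule integrable_between)
    let ?h = "\<lambda>\<theta>. (\<rho> * (w \<theta> * log_ratio X \<theta>) + w \<theta> * ln (w \<theta>) + (ln 1 - 1) * w \<theta> + tilted X \<theta> / 1) / (\<alpha> * real n)"
    show "integrable \<pi> (\<lambda>_. 0 :: real)" "(\<lambda>\<theta>. w \<theta> * ?a \<theta>) \<in> borel_measurable \<pi>"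
      by measurable
    show "integrable \<pi> ?h"
      using lr_int ent w_int tilted by simp
    show "AE \<theta> in \<pi>. 0 \<le> w \<theta> * ?a \<theta>"
      using AE_space by eventually_elim (intro mult_nonneg_nonneg w_nonneg a_nonneg)
    show "AE \<theta> in \<pi>. w \<theta> * ?a \<theta> \<le> ?h \<theta>"
      using young[OF zero_less_one]
      by eventually_elim (use \<alpha>_pos n_pos in \<open>simp add: pos_le_divide_eq ac_simps\<close>)
  qed

  assume K: "0 < K"
  have "\<alpha> * real n * (\<integral>\<theta>. w \<theta> * ?a \<theta> \<partial>\<pi>) = (\<integral>\<theta>. \<alpha> * real n * (w \<theta> * ?a \<theta>) \<partial>\<pi>)"
    by simp
  also have "\<dots> \<le> (\<integral>\<theta>. \<rho> * (w \<theta> * log_ratio X \<theta>) + w \<theta> * ln (w \<theta>) + (ln K - 1) * w \<theta> + tilted X \<theta> / K \<partial>\<pi>)"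
    by (rule integral_mono_AE[OF _ _ young[OF K]]) (use wa_int lr_int ent w_int tilted in auto)
  also have "\<dots> = \<rho> * (\<integral>\<theta>. w \<theta> * log_ratio X \<theta> \<partial>\<pi>) + (\<integral>\<theta>. w \<theta> * ln (w \<theta>) \<partial>\<pi>)
        + (ln K - 1) + (\<integral>\<theta>. tilted X \<theta> \<partial>\<pi>) / K"
    using lr_int ent w_int tilted by simp
  finally show "\<alpha> * real n * (\<integral>\<theta>. w \<theta> * ?a \<theta> \<partial>\<pi>)
      \<le> \<rho> * (\<integral>\<theta>. w \<theta> * log_ratio X \<theta> \<partial>\<pi>) + (\<integral>\<theta>. w \<theta> * ln (w \<theta>) \<partial>\<pi>)
        + (ln K - 1) + (\<integral>\<theta>. tilted X \<theta> \<partial>\<pi>) / K" .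
qed

section \<open>Competitors of finite risk\<close>

lemma measurable_eln_ratio:
  assumes "\<theta> \<in> space \<pi>"
  shows "(\<lambda>x. eln (ereal (q x) / ereal (p \<theta> x))) \<in> borel_measurable truth"
proof -
  have [measurable]: "p \<theta> \<in> borel_measurable \<mu>"
    using p_density[OF assms] by (simp add: prob_density_def)
  show ?thesis
    by measurable
qed

lemma measurable_D_KL: "(\<lambda>\<theta>. D_KL \<mu> q (p \<theta>)) \<in> borel_measurable \<pi>"
  unfolding D_KL_def
  by (rule measurable_ext_integral[OF truth.sigma_finite_measure_axioms]) measurable

text \<open>
  From \<open>ln (p / q) \<le> p / q\<close>.
\<close>

lemma nn_integral_neg_log_ratio_le_1:
  assumes "\<theta> \<in> space \<pi>"
  shows "(\<integral>\<^sup>+x. e2ennreal (- eln (ereal (q x) / ereal (p \<theta> x))) \<partial>truth) \<le> 1"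
proof -
  have "(\<integral>\<^sup>+x. e2ennreal (- eln (ereal (q x) / ereal (p \<theta> x))) \<partial>truth)
      \<le> (\<integral>\<^sup>+x. ennreal (p \<theta> x / q x) \<partial>truth)"
  proof (rule nn_integral_mono_AE)
    show "AE x in truth. e2ennreal (- eln (ereal (q x) / ereal (p \<theta> x))) \<le> ennreal (p \<theta> x / q x)"
      using AE_truth_q_pos AE_space
    proof eventually_elim
      case (elim x)
      then have x: "0 < q x" "0 \<le> p \<theta> x"
        using p_nonneg[OF assms] by auto
      show ?case
      proof (cases "p \<theta> x = 0")
        case True
        then show ?thesis
          unfolding eln_ratio[OF x] by (simp add: e2ennreal_neg)
      next
        case False
        with x have "ln (p \<theta> x / q x) \<le> p \<theta> x / q x - 1"
          by (intro ln_le_minus_one) simp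
        then show ?thesis
          unfolding eln_ratio[OF x] using False x by (simp add: ln_div ennreal_leI)
      qed
    qed
  qed
  with nn_integral_ratio_le_1[OF assms] show ?thesis
    by simp
qed

lemma positive_part_le:
  fixes a b :: ennreal
  assumes "b \<le> 1"
  shows "a \<le> e2ennreal (enn2ereal a - enn2ereal b) + 1"
proof -
  from assms have "b \<noteq> \<infinity>"
    by (auto simp: top_unique)
  then obtain s where s: "b = ennreal s" "0 \<le> s"
    by (metis ennreal_cases infinity_ennreal_def)
  have "s \<le> 1"
    using assms s by simp
  show ?thesis
  proof (cases a)
    case (real r)
    have "ennreal r \<le> ennreal (max 0 (r - s) + 1)"
      using \<open>s \<le> 1\<close> by (intro ennreal_leI) auto
    also have "\<dots> = e2ennreal (enn2ereal a - enn2ereal b) + 1"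
      using real s by (subst ennreal_plus) (auto simp: enn2ereal_ennreal max_def ennreal_neg)
    finally show ?thesis
      using real by simp
  next
    case top
    then show ?thesis
      using s by (simp add: top_ennreal.rep_eq top_ereal_def enn2ereal_ennreal)
  qed
qed

lemma e2ennreal_ereal_mult:
  assumes "0 \<le> r"
  shows "e2ennreal (ereal r * x) = ennreal r * e2ennreal x"
proof (cases x)
  case (real y)
  then show ?thesis
    using assms by (cases "0 \<le> y") (auto simp: ennreal_mult ennreal_neg mult_nonneg_nonpos)
next
  case PInf
  then show ?thesis
    using assms by (cases "r = 0") (auto simp: ennreal_mult_top zero_ereal_def[symmetric])
next
  case MInf
  then show ?thesis
    using assms by (cases "r = 0") (auto simp: zero_ereal_def[symmetric] e2ennreal_neg)
qed

text \<open>
  The negative part of \<open>w ln (q / p)\<close> has mass at most \<open>\<integral> w d\<pi> = 1\<close>, so finiteness of the averaged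
  divergence makes the positive part integrable over observation and parameter jointly, and Fubini
  applies.
\<close>

lemma finite_risk_Fubini:
  assumes w: "prob_density \<pi> w" and fin: "ext_integral \<pi> (\<lambda>\<theta>. ereal (w \<theta>) * D_KL \<mu> q (p \<theta>)) < \<infinity>"
  defines "h \<equiv> \<lambda>x \<theta>. w \<theta> * (ln (q x) - ln (p \<theta> x))"
  shows "AE x in truth. AE \<theta> in \<pi>. w \<theta> \<noteq> 0 \<longrightarrow> 0 < p \<theta> x"
    and "integrable (truth \<Otimes>\<^sub>M \<pi>) (\<lambda>(x, \<theta>). h x \<theta>)"
    and "ext_integral \<pi> (\<lambda>\<theta>. ereal (w \<theta>) * D_KL \<mu> q (p \<theta>)) = ereal (\<integral>x. \<integral>\<theta>. h x \<theta> \<partial>\<pi> \<partial>truth)"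
proof -
  let ?e = "\<lambda>\<theta> x. eln (ereal (q x) / ereal (p \<theta> x))"
  let ?kp = "\<lambda>\<theta>. \<integral>\<^sup>+x. e2ennreal (?e \<theta> x) \<partial>truth" and ?kn = "\<lambda>\<theta>. \<integral>\<^sup>+x. e2ennreal (- ?e \<theta> x) \<partial>truth"
  have w_nonneg: "\<And>\<theta>. \<theta> \<in> space \<pi> \<Longrightarrow> 0 \<le> w \<theta>" and [measurable]: "w \<in> borel_measurable \<pi>"
    and w_mass: "(\<integral>\<^sup>+\<theta>. ennreal (w \<theta>) \<partial>\<pi>) = 1"
    using w by (auto simp: prob_density_def)
  have h_meas [measurable]: "(\<lambda>(x, \<theta>). h x \<theta>) \<in> borel_measurable (truth \<Otimes>\<^sub>M \<pi>)"
    unfolding h_def by measurable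
  note measurable_D_KL [measurable]
  have [measurable]: "?kp \<in> borel_measurable \<pi>"
    by measurable

  have "(\<integral>\<^sup>+\<theta>. ennreal (w \<theta>) * ?kp \<theta> \<partial>\<pi>)
      \<le> (\<integral>\<^sup>+\<theta>. e2ennreal (ereal (w \<theta>) * D_KL \<mu> q (p \<theta>)) + ennreal (w \<theta>) \<partial>\<pi>)"
  proof (rule nn_integral_mono)
    fix \<theta> assume \<theta>: "\<theta> \<in> space \<pi>"
    have "?kp \<theta> \<le> e2ennreal (D_KL \<mu> q (p \<theta>)) + 1"
      using positive_part_le[OF nn_integral_neg_log_ratio_le_1[OF \<theta>]]
      by (simp add: D_KL_def ext_integral_def)
    then have "ennreal (w \<theta>) * ?kp \<theta> \<le> ennreal (w \<theta>) * (e2ennreal (D_KL \<mu> q (p \<theta>)) + 1)"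
      by (rule mult_left_mono) simp
    then show "ennreal (w \<theta>) * ?kp \<theta> \<le> e2ennreal (ereal (w \<theta>) * D_KL \<mu> q (p \<theta>)) + ennreal (w \<theta>)"
      using w_nonneg[OF \<theta>] by (simp add: e2ennreal_ereal_mult distrib_left)
  qed
  also have "\<dots> = (\<integral>\<^sup>+\<theta>. e2ennreal (ereal (w \<theta>) * D_KL \<mu> q (p \<theta>)) \<partial>\<pi>) + 1"
    by (subst nn_integral_add) (simp_all add: w_mass)
  also have "\<dots> < \<infinity>"
    using nn_integral_less_top_if_ext_integral_less_top[OF fin] by simp
  finally have kp_fin: "(\<integral>\<^sup>+\<theta>. ennreal (w \<theta>) * ?kp \<theta> \<partial>\<pi>) < \<infinity>" .

  have "AE \<theta> in \<pi>. ennreal (w \<theta>) * ?kp \<theta> \<noteq> \<infinity>"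
    by (rule nn_integral_PInf_AE) (use kp_fin in auto)
  then have p_pos: "AE \<theta> in \<pi>. AE x in truth. w \<theta> \<noteq> 0 \<longrightarrow> 0 < p \<theta> x"
    using AE_space
  proof eventually_elim
    case (elim \<theta>)
    show ?case
    proof (cases "w \<theta> = 0")
      case False
      then have "?kp \<theta> \<noteq> \<infinity>"
        using elim w_nonneg[OF elim(2)] by (auto simp: ennreal_mult_eq_top_iff)
      moreover have "(\<lambda>x. e2ennreal (?e \<theta> x)) \<in> borel_measurable truth"
        using measurable_compose[OF measurable_eln_ratio[OF elim(2)] measurable_e2ennreal] .
      ultimately have "AE x in truth. e2ennreal (?e \<theta> x) \<noteq> \<infinity>"
        by (intro nn_integral_PInf_AE)
      then show ?thesis
        using AE_truth_q_pos AE_space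
      proof eventually_elim
        case (elim x)
        then show ?case
          using p_nonneg[OF \<open>\<theta> \<in> space \<pi>\<close>, of x] eln_ratio[of "q x" "p \<theta> x"]
          by (cases "p \<theta> x = 0") auto
      qed
    qed simp
  qed
  show p_pos': "AE x in truth. AE \<theta> in \<pi>. w \<theta> \<noteq> 0 \<longrightarrow> 0 < p \<theta> x"
    by (rule truth_prior.AE_commute[where P = "\<lambda>x \<theta>. w \<theta> \<noteq> 0 \<longrightarrow> 0 < p \<theta> x", THEN iffD2, OF _ p_pos])
       measurable
  have h_eq: "AE \<theta> in \<pi>. AE x in truth. ereal (h x \<theta>) = ereal (w \<theta>) * ?e \<theta> x"
    using p_pos
  proof eventually_elim
    case (elim \<theta>)
    then show ?case
      using AE_truth_q_pos
    proof eventually_elim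
      case (elim x)
      then show ?case
        using eln_ratio[of "q x" "p \<theta> x"]
        by (cases "w \<theta> = 0") (auto simp: h_def zero_ereal_def[symmetric] less_imp_le)
    qed
  qed

  have parts: "AE \<theta> in \<pi>. (\<integral>\<^sup>+x. ennreal (h x \<theta>) \<partial>truth) = ennreal (w \<theta>) * ?kp \<theta> \<and>
      (\<integral>\<^sup>+x. ennreal (- h x \<theta>) \<partial>truth) = ennreal (w \<theta>) * ?kn \<theta>"
    using h_eq AE_space
  proof eventually_elim
    case (elim \<theta>)
    note meas = measurable_eln_ratio[OF elim(2)]
    have "(\<integral>\<^sup>+x. ennreal (h x \<theta>) \<partial>truth) = (\<integral>\<^sup>+x. ennreal (w \<theta>) * e2ennreal (?e \<theta> x) \<partial>truth)"
    proof (rule nn_integral_cong_AE, use elim(1) in eventually_elim)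
      fix x assume "ereal (h x \<theta>) = ereal (w \<theta>) * ?e \<theta> x"
      then have "e2ennreal (ereal (h x \<theta>)) = e2ennreal (ereal (w \<theta>) * ?e \<theta> x)"
        by simp
      then show "ennreal (h x \<theta>) = ennreal (w \<theta>) * e2ennreal (?e \<theta> x)"
        unfolding e2ennreal_ereal_mult[OF w_nonneg[OF elim(2)]] by simp
    qed
    moreover have "(\<integral>\<^sup>+x. ennreal (- h x \<theta>) \<partial>truth) = (\<integral>\<^sup>+x. ennreal (w \<theta>) * e2ennreal (- ?e \<theta> x) \<partial>truth)"
    proof (rule nn_integral_cong_AE, use elim(1) in eventually_elim)
      fix x assume "ereal (h x \<theta>) = ereal (w \<theta>) * ?e \<theta> x"
      then have "e2ennreal (- ereal (h x \<theta>)) = e2ennreal (ereal (w \<theta>) * - ?e \<theta> x)"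
        by (simp flip: ereal_mult_minus_right)
      then show "ennreal (- h x \<theta>) = ennreal (w \<theta>) * e2ennreal (- ?e \<theta> x)"
        unfolding e2ennreal_ereal_mult[OF w_nonneg[OF elim(2)]] by simp
    qed
    ultimately show ?case
      using nn_integral_cmult[OF measurable_compose[OF meas measurable_e2ennreal], of "ennreal (w \<theta>)"]
        nn_integral_cmult[OF measurable_compose[OF borel_measurable_uminus_ereal[OF meas] measurable_e2ennreal], of "ennreal (w \<theta>)"]
      by (simp only: simp_thms)
  qed

  show h_int: "integrable (truth \<Otimes>\<^sub>M \<pi>) (\<lambda>(x, \<theta>). h x \<theta>)"
  proof (rule integrable_if_parts_finite[OF h_meas])
    have "(\<integral>\<^sup>+z. ennreal (case z of (x, \<theta>) \<Rightarrow> h x \<theta>) \<partial>(truth \<Otimes>\<^sub>M \<pi>))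
        = (\<integral>\<^sup>+\<theta>. \<integral>\<^sup>+x. ennreal (h x \<theta>) \<partial>truth \<partial>\<pi>)"
      using truth_prior.nn_integral_snd[of "\<lambda>z. ennreal (case z of (x, \<theta>) \<Rightarrow> h x \<theta>)"] by simp
    also have "\<dots> = (\<integral>\<^sup>+\<theta>. ennreal (w \<theta>) * ?kp \<theta> \<partial>\<pi>)"
      by (rule nn_integral_cong_AE) (use parts in eventually_elim, simp)
    finally show "(\<integral>\<^sup>+z. ennreal (case z of (x, \<theta>) \<Rightarrow> h x \<theta>) \<partial>(truth \<Otimes>\<^sub>M \<pi>)) < \<infinity>"
      using kp_fin by simp
    have "(\<integral>\<^sup>+z. ennreal (- (case z of (x, \<theta>) \<Rightarrow> h x \<theta>)) \<partial>(truth \<Otimes>\<^sub>M \<pi>))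
        = (\<integral>\<^sup>+\<theta>. \<integral>\<^sup>+x. ennreal (- h x \<theta>) \<partial>truth \<partial>\<pi>)"
      using truth_prior.nn_integral_snd[of "\<lambda>z. ennreal (- (case z of (x, \<theta>) \<Rightarrow> h x \<theta>))"] by simp
    also have "\<dots> \<le> (\<integral>\<^sup>+\<theta>. ennreal (w \<theta>) \<partial>\<pi>)"
    proof (rule nn_integral_mono_AE, use parts AE_space in eventually_elim)
      case (elim \<theta>)
      show ?case
        using mult_left_mono[OF nn_integral_neg_log_ratio_le_1[OF elim(2)], of "ennreal (w \<theta>)"] elim(1) by simp
    qed
    also have "\<dots> < \<infinity>"
      by (simp add: w_mass)
    finally show "(\<integral>\<^sup>+z. ennreal (- (case z of (x, \<theta>) \<Rightarrow> h x \<theta>)) \<partial>(truth \<Otimes>\<^sub>M \<pi>)) < \<infinity>" .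
  qed

  have "AE \<theta> in \<pi>. ereal (w \<theta>) * D_KL \<mu> q (p \<theta>) = ereal (\<integral>x. h x \<theta> \<partial>truth)"
    using h_eq truth_prior.AE_integrable_snd[OF h_int]
  proof eventually_elim
    case (elim \<theta>)
    show ?case
    proof (cases "w \<theta> = 0")
      case False
      let ?l = "\<lambda>x. h x \<theta> / w \<theta>"
      have "AE x in truth. ?e \<theta> x = ereal (?l x)"
        using elim(1)
      proof eventually_elim
        case (elim x)
        then show ?case
          using False by (cases "?e \<theta> x") (auto split: if_splits)
      qed
      then have "D_KL \<mu> q (p \<theta>) = ext_integral truth (\<lambda>x. ereal (?l x))"
        unfolding D_KL_def by (rule ext_integral_cong_AE)
      also have "\<dots> = ereal (\<integral>x. ?l x \<partial>truth)"
        using elim(2) by (intro ext_integral_ereal) simp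
      finally show ?thesis
        using False by simp
    qed (simp add: h_def zero_ereal_def[symmetric])
  qed
  then have "ext_integral \<pi> (\<lambda>\<theta>. ereal (w \<theta>) * D_KL \<mu> q (p \<theta>)) = ereal (\<integral>\<theta>. \<integral>x. h x \<theta> \<partial>truth \<partial>\<pi>)"
    using ext_integral_ereal[OF truth_prior.integrable_snd[OF h_int]]
    by (simp add: ext_integral_cong_AE)
  then show "ext_integral \<pi> (\<lambda>\<theta>. ereal (w \<theta>) * D_KL \<mu> q (p \<theta>)) = ereal (\<integral>x. \<integral>\<theta>. h x \<theta> \<partial>\<pi> \<partial>truth)"
    by (simp add: truth_prior.Fubini_integral[OF h_int])
qed

text \<open>
  For a weight that does not depend on the sample, the empirical log-ratio is a sum of \<open>n\<close> identically
  distributed integrable functions of one observation each.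
\<close>

lemma expected_empirical_risk:
  assumes w: "prob_density \<pi> w" and l: "0 < l" and fin: "R_true \<mu> q p \<pi> n l w < \<infinity>"
  shows "AE X in samples. regular_at X w"
    and "integrable samples (\<lambda>X. \<integral>\<theta>. w \<theta> * log_ratio X \<theta> \<partial>\<pi>)"
    and "R_true \<mu> q p \<pi> n l w =
      ereal (((\<integral>X. \<integral>\<theta>. w \<theta> * log_ratio X \<theta> \<partial>\<pi> \<partial>samples) + l * (\<integral>\<theta>. w \<theta> * ln (w \<theta>) \<partial>\<pi>)) / real n)"
proof -
  have KLD: "ext_integral \<pi> (\<lambda>\<theta>. ereal (w \<theta>) * D_KL \<mu> q (p \<theta>)) < \<infinity>" and KL: "KL_prior \<pi> w < \<infinity>"
    using fin l n_pos by (auto simp: R_true_def ereal_mult_infty)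
  have ent: "integrable \<pi> (\<lambda>\<theta>. w \<theta> * ln (w \<theta>))"
    by (rule integrable_entropy[OF w prior KL])
  define h where "h = (\<lambda>x \<theta>. w \<theta> * (ln (q x) - ln (p \<theta> x)))"
  define u where "u = (\<lambda>x. \<integral>\<theta>. h x \<theta> \<partial>\<pi>)"
  note F = finite_risk_Fubini[OF w KLD, folded h_def]
  have "AE x in truth. integrable \<pi> (h x)"
    using truth_prior.AE_integrable_fst[OF F(2)] by simp
  note AE_h = AE_samples_component[OF this]
  have u_int: "integrable truth u"
    unfolding u_def by (rule truth_prior.integrable_fst[OF F(2)])
  have w_log_ratio: "w \<theta> * log_ratio X \<theta> = (\<Sum>i<n. h (X i) \<theta>)" for X \<theta>
    by (simp add: log_ratio_def h_def sum_distrib_left)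
  show "AE X in samples. regular_at X w"
    using AE_h AE_samples_component[OF AE_truth_q_pos] AE_samples_component[OF F(1)]
  proof eventually_elim
    case (elim X)
    have "AE \<theta> in \<pi>. \<forall>i\<in>{..<n}. w \<theta> \<noteq> 0 \<longrightarrow> 0 < p \<theta> (X i)"
      using elim(3) by (intro AE_finite_allI) auto
    then have "AE \<theta> in \<pi>. w \<theta> \<noteq> 0 \<longrightarrow> (\<forall>i<n. 0 < p \<theta> (X i))"
      by eventually_elim auto
    then show ?case
      using elim ent by (auto simp: regular_at_def w_log_ratio)
  qed
  have eq: "AE X in samples. (\<integral>\<theta>. w \<theta> * log_ratio X \<theta> \<partial>\<pi>) = (\<Sum>i<n. u (X i))"
    using AE_h by eventually_elim (simp add: w_log_ratio u_def)
  have comp: "integrable samples (\<lambda>X. u (X i))" "(\<integral>X. u (X i) \<partial>samples) = (\<integral>x. u x \<partial>truth)" if "i < n" for i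
  proof -
    have distr: "distr samples truth (\<lambda>X. X i) = truth"
      unfolding sample_law_def using that truth.prob_space_axioms by (intro distr_PiM_component) auto
    have meas: "(\<lambda>X. X i) \<in> measurable samples truth"
      using measurable_sample_component(1)[OF that] by (simp cong: measurable_cong_sets)
    show "integrable samples (\<lambda>X. u (X i))"
      using integrable_distr[OF meas, of u] u_int by (simp add: distr)
    show "(\<integral>X. u (X i) \<partial>samples) = (\<integral>x. u x \<partial>truth)"
      using integral_distr[OF meas, of u] u_int by (simp add: distr)
  qed
  have sum_int: "integrable samples (\<lambda>X. \<Sum>i<n. u (X i))"
    using comp(1) by auto
  have meas: "(\<lambda>X. \<integral>\<theta>. w \<theta> * log_ratio X \<theta> \<partial>\<pi>) \<in> borel_measurable samples"
  proof (rule prior.borel_measurable_lebesgue_integral)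
    have "(\<lambda>z. w (snd z)) \<in> borel_measurable (samples \<Otimes>\<^sub>M \<pi>)"
      using w by (intro measurable_compose[OF measurable_snd]) (simp add: prob_density_def)
    from borel_measurable_times[OF this measurable_log_ratio]
    show "(\<lambda>(X, \<theta>). w \<theta> * log_ratio X \<theta>) \<in> borel_measurable (samples \<Otimes>\<^sub>M \<pi>)"
      by (simp add: split_beta')
  qed
  show "integrable samples (\<lambda>X. \<integral>\<theta>. w \<theta> * log_ratio X \<theta> \<partial>\<pi>)"
    by (rule integrable_cong_AE_imp[OF sum_int meas]) (use eq in eventually_elim, simp)
  have "(\<integral>X. \<integral>\<theta>. w \<theta> * log_ratio X \<theta> \<partial>\<pi> \<partial>samples) = (\<integral>X. (\<Sum>i<n. u (X i)) \<partial>samples)"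
    by (rule integral_cong_AE[OF meas _ eq]) (use sum_int in auto)
  also have "\<dots> = real n * (\<integral>x. u x \<partial>truth)"
    using comp by simp
  finally show "R_true \<mu> q p \<pi> n l w =
      ereal (((\<integral>X. \<integral>\<theta>. w \<theta> * log_ratio X \<theta> \<partial>\<pi> \<partial>samples) + l * (\<integral>\<theta>. w \<theta> * ln (w \<theta>) \<partial>\<pi>)) / real n)"
    using n_pos F(3) ext_integral_ereal[OF ent]
    by (simp add: R_true_def KL_prior_def u_def h_def add_divide_distrib)
qed

section \<open>Integrating the entropy bound over the sample\<close>

lemma c_const_affinity:
  "c_const \<mu> q p \<pi> n \<rho> \<alpha> = ereal (1 / real n) *
     eln (enn2ereal (\<integral>\<^sup>+\<theta>. e2ennreal (epowr (affinity \<theta>) ((1 - \<alpha>) * real n)) \<partial>\<pi>))"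
  unfolding c_const_def affinity_def[symmetric]
  by (subst ext_integral_eq_nn_integral) (simp_all add: epowr_nonneg)

text \<open>
  The bound against a single competitor \<open>w\<close>. Its finite risk and the exclusion of infinite values for
  \<open>c_const\<close> and the empirical term force every term to be real: for the estimator, finiteness of its
  objective is inherited from \<open>w\<close> by minimality, sample by sample.
\<close>

lemma icm_risk_bound:
  fixes S :: "('t \<Rightarrow> real) set" and w_hat :: "(nat \<Rightarrow> 'a) \<Rightarrow> 't \<Rightarrow> real"
  assumes S_density: "\<And>w. w \<in> S \<Longrightarrow> prob_density \<pi> w"
    and lam_pos: "0 < lam"
    and objective_defined: "AE X in samples. \<forall>w\<in>S. icm_objective_defined p \<pi> n lam X w"
    and estimator: "AE X in samples. is_icm_minimizer p \<pi> n lam S X (w_hat X)"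
    and estimator_measurable: "(\<lambda>(X, \<theta>). w_hat X \<theta>) \<in> borel_measurable (samples \<Otimes>\<^sub>M \<pi>)"
    and \<gamma>_ge: "\<rho> \<le> \<gamma>"
    and weights: "(\<gamma> - \<rho>) * lam' = lam * \<gamma> - 1"
    and w: "w \<in> S" "R_true \<mu> q p \<pi> n lam w < \<infinity>"
    and c_fin: "c_const \<mu> q p \<pi> n \<rho> \<alpha> < \<infinity>"
    and E_fin: "\<rho> < \<gamma> \<Longrightarrow> -\<infinity> < ext_integral samples (\<lambda>X. R_hat q p \<pi> n lam' X (w_hat X))"
  obtains T e c r where
    "ext_integral samples (\<lambda>X. ext_integral \<pi> (\<lambda>\<theta>. ereal (w_hat X \<theta>) * D_Re \<mu> \<rho> q (p \<theta>))) = ereal T"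
    "ereal (\<gamma> - \<rho>) * ext_integral samples (\<lambda>X. R_hat q p \<pi> n lam' X (w_hat X)) = ereal e"
    "c_const \<mu> q p \<pi> n \<rho> \<alpha> = ereal c"
    "R_true \<mu> q p \<pi> n lam w = ereal r"
    "\<alpha> * \<rho> * (1 - \<rho>) * T \<le> \<gamma> * r - e + c"
proof -
  define Gn where "Gn = (\<integral>\<^sup>+\<theta>. e2ennreal (epowr (affinity \<theta>) ((1 - \<alpha>) * real n)) \<partial>\<pi>)"
  have "Gn \<noteq> \<infinity>"
    using c_fin n_pos by (auto simp: c_const_affinity Gn_def[symmetric] eln_def)
  then obtain G where G: "Gn = ennreal G" "0 \<le> G"
    by (metis ennreal_cases infinity_ennreal_def)

  define H where "H = (\<lambda>X. \<integral>\<theta>. tilted X \<theta> \<partial>\<pi>)"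
  have tilted_meas: "(\<lambda>(X, \<theta>). tilted X \<theta>) \<in> borel_measurable (samples \<Otimes>\<^sub>M \<pi>)"
    using measurable_tilted by (simp add: split_beta')
  have tilted_mass: "(\<integral>\<^sup>+z. ennreal (case z of (X, \<theta>) \<Rightarrow> tilted X \<theta>) \<partial>(samples \<Otimes>\<^sub>M \<pi>)) \<le> ennreal G"
  proof -
    have "(\<integral>\<^sup>+z. ennreal (case z of (X, \<theta>) \<Rightarrow> tilted X \<theta>) \<partial>(samples \<Otimes>\<^sub>M \<pi>))
        = (\<integral>\<^sup>+\<theta>. \<integral>\<^sup>+X. ennreal (tilted X \<theta>) \<partial>samples \<partial>\<pi>)"
      using samples_prior.nn_integral_snd[of "\<lambda>z. ennreal (case z of (X, \<theta>) \<Rightarrow> tilted X \<theta>)"] tilted_meas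
      by simp
    also have "\<dots> \<le> Gn"
      unfolding Gn_def by (intro nn_integral_mono nn_integral_tilted_le)
    finally show ?thesis
      by (simp add: G)
  qed
  have tilted_int: "integrable (samples \<Otimes>\<^sub>M \<pi>) (\<lambda>(X, \<theta>). tilted X \<theta>)"
  proof (rule integrableI_nonneg[OF tilted_meas])
    show "AE z in samples \<Otimes>\<^sub>M \<pi>. 0 \<le> (case z of (X, \<theta>) \<Rightarrow> tilted X \<theta>)"
      by (simp add: tilted_nonneg split_beta')
    show "(\<integral>\<^sup>+z. ennreal (case z of (X, \<theta>) \<Rightarrow> tilted X \<theta>) \<partial>(samples \<Otimes>\<^sub>M \<pi>)) < \<infinity>"
      using tilted_mass by (rule order_le_less_trans) simp
  qed
  have H_int: "integrable samples H"
    unfolding H_def by (rule samples_prior.integrable_fst[OF tilted_int])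
  have "ennreal (\<integral>X. H X \<partial>samples) \<le> ennreal G"
  proof -
    have "(\<integral>X. H X \<partial>samples) = (\<integral>z. (case z of (X, \<theta>) \<Rightarrow> tilted X \<theta>) \<partial>(samples \<Otimes>\<^sub>M \<pi>))"
      unfolding H_def by (rule samples_prior.integral_fst[OF tilted_int])
    also have "ennreal \<dots> = (\<integral>\<^sup>+z. ennreal (case z of (X, \<theta>) \<Rightarrow> tilted X \<theta>) \<partial>(samples \<Otimes>\<^sub>M \<pi>))"
      by (rule nn_integral_eq_integral[OF tilted_int, symmetric]) (simp add: tilted_nonneg split_beta')
    finally show ?thesis
      using tilted_mass by simp
  qed
  then have H_le: "(\<integral>X. H X \<partial>samples) \<le> G"
    using G(2) by (simp add: ennreal_le_iff)

  note competitor = expected_empirical_risk[OF S_density[OF w(1)] lam_pos w(2)]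
  define U V W where
    "U = (\<lambda>X. \<integral>\<theta>. w_hat X \<theta> * log_ratio X \<theta> \<partial>\<pi>)" and
    "V = (\<lambda>X. \<integral>\<theta>. w_hat X \<theta> * ln (w_hat X \<theta>) \<partial>\<pi>)" and
    "W = (\<lambda>X. \<integral>\<theta>. w_hat X \<theta> * - ln (affinity \<theta>) \<partial>\<pi>)"
  define U0 V0 where
    "U0 = (\<lambda>X. \<integral>\<theta>. w \<theta> * log_ratio X \<theta> \<partial>\<pi>)" and
    "V0 = (\<integral>\<theta>. w \<theta> * ln (w \<theta>) \<partial>\<pi>)"
  have "AE X in samples. AE \<theta> in \<pi>. affinity \<theta> = 0 \<longrightarrow> (p \<theta> (X 0) / q (X 0)) powr \<rho> = 0"
    using AE_samples_component[OF AE_affinity_zero] by eventually_elim (use n_pos in auto)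
  then have "AE X in samples. X \<in> space samples \<and> prob_density \<pi> (w_hat X) \<and> regular_at X (w_hat X) \<and>
      (AE \<theta> in \<pi>. w_hat X \<theta> \<noteq> 0 \<longrightarrow> 0 < affinity \<theta>) \<and>
      integrable \<pi> (\<lambda>\<theta>. w_hat X \<theta> * - ln (affinity \<theta>)) \<and>
      U X + lam * V X \<le> U0 X + lam * V0 \<and>
      (\<forall>K>0. \<alpha> * real n * W X \<le> \<rho> * U X + V X + (ln K - 1) + H X / K)"
    using AE_space AE_samples_component[OF AE_truth_q_pos] samples_prior.AE_integrable_fst[OF tilted_int]
      objective_defined estimator competitor(1)
  proof eventually_elim
    case (elim X)
    have hat: "w_hat X \<in> S" "icm_objective p \<pi> n lam X (w_hat X) \<le> icm_objective p \<pi> n lam X w"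
      using elim(6) w(1) by (auto simp: is_icm_minimizer_def is_arg_min_def not_less)
    note obj_w = icm_objective_regular[OF S_density[OF w(1)] elim(7), of lam]
    have fin: "icm_objective p \<pi> n lam X (w_hat X) < \<infinity>"
      using hat(2) by (rule order_le_less_trans) (simp add: obj_w)
    have A0: "AE \<theta> in \<pi>. affinity \<theta> = 0 \<longrightarrow> (\<exists>i<n. p \<theta> (X i) = 0)"
      using elim(1) by eventually_elim (use elim(3) n_pos in force)
    have "icm_objective_defined p \<pi> n lam X (w_hat X)"
      using elim(5) hat(1) by blast
    note bound = entropy_bound[OF elim(2,3) S_density[OF hat(1)] lam_pos this fin A0 elim(4)]
    have "U X + lam * V X \<le> U0 X + lam * V0"
      using hat(2) obj_w icm_objective_regular[OF S_density[OF hat(1)] bound(1), of lam]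
      by (simp add: U_def V_def U0_def V0_def)
    then show ?case
      using elim(2) S_density[OF hat(1)] bound by (auto simp: U_def V_def W_def H_def)
  qed
  note facts = this

  \<comment> \<open>Mass \<open>G = 0\<close> would mean that almost every \<open>p \<theta>\<close> is singular to \<open>q\<close>, but the estimator
    almost surely lives on positive affinity.\<close>
  have "G \<noteq> 0"
  proof
    assume "G = 0"
    have "(\<lambda>\<theta>. epowr (affinity \<theta>) ((1 - \<alpha>) * real n)) \<in> borel_measurable \<pi>"
      unfolding epowr_def by measurable
    then have "AE \<theta> in \<pi>. e2ennreal (epowr (affinity \<theta>) ((1 - \<alpha>) * real n)) = 0"
      using G(1) \<open>G = 0\<close> unfolding Gn_def by (subst nn_integral_0_iff_AE[symmetric]) auto
    then have zero: "AE \<theta> in \<pi>. affinity \<theta> = 0"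
      by eventually_elim (auto simp: epowr_def split: if_splits)
    have "AE X in samples. False"
      using facts
    proof eventually_elim
      case (elim X)
      then have "AE \<theta> in \<pi>. w_hat X \<theta> = 0"
        using zero by (auto elim!: eventually_rev_mp)
      then have "(\<integral>\<theta>. w_hat X \<theta> \<partial>\<pi>) = 0"
        by (simp add: integral_eq_zero_AE)
      then show False
        using prob_density_integral(2)[of \<pi> "w_hat X"] elim by simp
    qed
    then show False
      by (simp add: samples.AE_False)
  qed
  with G have "0 < G"
    by simp

  define B where "B = (\<lambda>X. \<gamma> * (U0 X + lam * V0) + (ln G - 1) + H X / G)"
  define F where "F = (\<lambda>X. (U X + lam' * V X) / real n)"
  have "integrable samples U0"
    using competitor(2) by (simp add: U0_def)
  then have B_int: "integrable samples B"
    and B_integral: "(\<integral>X. B X \<partial>samples) = \<gamma> * ((\<integral>X. U0 X \<partial>samples) + lam * V0) + (ln G - 1) + (\<integral>X. H X \<partial>samples) / G"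
    unfolding B_def using H_int samples.prob_space by simp_all

  have w_hat_meas: "(\<lambda>z. w_hat (fst z) (snd z)) \<in> borel_measurable (samples \<Otimes>\<^sub>M \<pi>)"
    using estimator_measurable by (simp add: split_beta')
  note meas [measurable] = w_hat_meas measurable_log_ratio
  have U_meas [measurable]: "U \<in> borel_measurable samples"
    unfolding U_def by (rule prior.borel_measurable_lebesgue_integral) (simp add: split_beta', measurable)
  have V_meas [measurable]: "V \<in> borel_measurable samples"
    unfolding V_def by (rule prior.borel_measurable_lebesgue_integral) (simp add: split_beta', measurable)
  have W_meas [measurable]: "W \<in> borel_measurable samples"
    unfolding W_def by (rule prior.borel_measurable_lebesgue_integral) (simp add: split_beta', measurable)
  have F_meas [measurable]: "F \<in> borel_measurable samples"
    unfolding F_def by measurable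

  have W_nonneg: "AE X in samples. 0 \<le> W X"
    using facts
  proof eventually_elim
    case (elim X)
    have "0 \<le> w_hat X \<theta> * - ln (affinity \<theta>)" if "\<theta> \<in> space \<pi>" for \<theta>
    proof (rule mult_nonneg_nonneg)
      show "0 \<le> w_hat X \<theta>"
        using elim that by (simp add: prob_density_def)
      show "0 \<le> - ln (affinity \<theta>)"
        using affinity_nonneg[of \<theta>] affinity_le_1[OF that]
        by (cases "affinity \<theta> = 0") (auto simp: ln_le_zero_iff)
    qed
    then show ?case
      unfolding W_def by (intro integral_nonneg_AE AE_I2)
  qed
  have main: "AE X in samples. \<alpha> * real n * W X + (\<gamma> - \<rho>) * real n * F X \<le> B X"
    using facts
  proof eventually_elim
    case (elim X)
    have "real n * F X = U X + lam' * V X"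
      using n_pos by (simp add: F_def)
    then have "(\<gamma> - \<rho>) * real n * F X = (\<gamma> - \<rho>) * U X + ((\<gamma> - \<rho>) * lam') * V X"
      by (simp only: mult.assoc distrib_left)
    also have "\<dots> = \<gamma> * (U X + lam * V X) - \<rho> * U X - V X"
      unfolding weights by (simp add: algebra_simps)
    also have "\<dots> \<le> \<gamma> * (U0 X + lam * V0) - \<rho> * U X - V X"
      using elim \<gamma>_ge \<rho>_range by (simp add: mult_left_mono)
    finally show ?case
      using elim \<open>0 < G\<close> by (force simp: B_def)
  qed
  have R_hat_F: "AE X in samples. R_hat q p \<pi> n lam' X (w_hat X) = ereal (F X)"
    using facts by eventually_elim (simp add: R_hat_regular F_def U_def V_def)

  \<comment> \<open>The lower bound on the empirical term is available for \<open>\<rho> < \<gamma>\<close>; if \<open>\<gamma> = \<rho>\<close>, then \<open>F\<close> enters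
    with the factor \<open>0\<close> only.\<close>
  have F_int: "integrable samples F" if "\<rho> < \<gamma>"
  proof (rule integrable_if_ext_integral_greater_bot[where h = "\<lambda>X. B X / ((\<gamma> - \<rho>) * real n)"])
    show "AE X in samples. F X \<le> B X / ((\<gamma> - \<rho>) * real n)"
      using main W_nonneg
    proof eventually_elim
      case (elim X)
      then have "0 \<le> \<alpha> * real n * W X"
        using \<alpha>_pos by simp
      then have "F X * ((\<gamma> - \<rho>) * real n) \<le> B X"
        using elim(1) by (simp add: algebra_simps)
      then show ?case
        using that n_pos by (simp add: pos_le_divide_eq)
    qed
    show "-\<infinity> < ext_integral samples (\<lambda>X. ereal (F X))"
      using E_fin[OF that] ext_integral_cong_AE[OF R_hat_F] by simp
  qed (use B_int in simp_all)
  have gF_int: "integrable samples (\<lambda>X. (\<gamma> - \<rho>) * F X)"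
    using F_int \<gamma>_ge by (cases "\<rho> = \<gamma>") auto
  have W_int: "integrable samples W"
  proof (rule integrable_between[OF _ _ W_meas W_nonneg])
    show "integrable samples (\<lambda>X. (B X - real n * ((\<gamma> - \<rho>) * F X)) / (\<alpha> * real n))"
      by (rule integrable_divide, rule Bochner_Integration.integrable_diff[OF B_int],
          rule integrable_mult_right, rule gF_int)
    show "AE X in samples. W X \<le> (B X - real n * ((\<gamma> - \<rho>) * F X)) / (\<alpha> * real n)"
      using main by eventually_elim (use \<alpha>_pos n_pos in \<open>simp add: pos_le_divide_eq algebra_simps\<close>)
  qed simp

  have H_G: "(\<integral>X. H X \<partial>samples) / G \<le> 1"
    using H_le \<open>0 < G\<close> by simp
  have "(\<integral>X. \<alpha> * real n * W X + real n * ((\<gamma> - \<rho>) * F X) \<partial>samples) \<le> (\<integral>X. B X \<partial>samples)"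
  proof (rule integral_mono_AE[OF _ B_int])
    show "integrable samples (\<lambda>X. \<alpha> * real n * W X + real n * ((\<gamma> - \<rho>) * F X))"
      by (rule Bochner_Integration.integrable_add; rule integrable_mult_right; rule W_int gF_int)
    show "AE X in samples. \<alpha> * real n * W X + real n * ((\<gamma> - \<rho>) * F X) \<le> B X"
      using main by eventually_elim (simp add: algebra_simps)
  qed
  also have "(\<integral>X. \<alpha> * real n * W X + real n * ((\<gamma> - \<rho>) * F X) \<partial>samples)
      = \<alpha> * real n * (\<integral>X. W X \<partial>samples) + real n * (\<integral>X. (\<gamma> - \<rho>) * F X \<partial>samples)"
    using W_int gF_int by (subst Bochner_Integration.integral_add) (auto intro!: integrable_mult_right simp del: mult_cancel_left)
  finally have "\<alpha> * real n * (\<integral>X. W X \<partial>samples) + real n * (\<integral>X. (\<gamma> - \<rho>) * F X \<partial>samples)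
      \<le> \<gamma> * ((\<integral>X. U0 X \<partial>samples) + lam * V0) + ln G"
    using H_G unfolding B_integral by linarith
  then have "(\<alpha> * (\<integral>X. W X \<partial>samples) + (\<integral>X. (\<gamma> - \<rho>) * F X \<partial>samples)) * real n
      \<le> \<gamma> * ((\<integral>X. U0 X \<partial>samples) + lam * V0) + ln G"
    by (simp add: algebra_simps)
  then have final: "\<alpha> * (\<integral>X. W X \<partial>samples) + (\<integral>X. (\<gamma> - \<rho>) * F X \<partial>samples)
      \<le> \<gamma> * (((\<integral>X. U0 X \<partial>samples) + lam * V0) / real n) + ln G / real n"
    using n_pos by (simp add: pos_le_divide_eq[symmetric] add_divide_distrib distrib_left)

  show thesis
  proof
    have "AE X in samples. ext_integral \<pi> (\<lambda>\<theta>. ereal (w_hat X \<theta>) * D_Re \<mu> \<rho> q (p \<theta>)) = ereal (W X / (\<rho> * (1 - \<rho>)))"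
      using facts
    proof eventually_elim
      case (elim X)
      have "AE \<theta> in \<pi>. ereal (w_hat X \<theta>) * D_Re \<mu> \<rho> q (p \<theta>)
          = ereal (w_hat X \<theta> * - ln (affinity \<theta>) / (\<rho> * (1 - \<rho>)))"
        using elim[THEN conjunct2, THEN conjunct2, THEN conjunct2, THEN conjunct1]
      proof eventually_elim
        case (elim \<theta>)
        then show ?case
          by (cases "w_hat X \<theta> = 0") (simp_all add: D_Re_eq zero_ereal_def[symmetric])
      qed
      then have "ext_integral \<pi> (\<lambda>\<theta>. ereal (w_hat X \<theta>) * D_Re \<mu> \<rho> q (p \<theta>))
          = ext_integral \<pi> (\<lambda>\<theta>. ereal (w_hat X \<theta> * - ln (affinity \<theta>) / (\<rho> * (1 - \<rho>))))"
        by (rule ext_integral_cong_AE)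
      also have "\<dots> = ereal (\<integral>\<theta>. w_hat X \<theta> * - ln (affinity \<theta>) / (\<rho> * (1 - \<rho>)) \<partial>\<pi>)"
        by (rule ext_integral_ereal, rule integrable_divide) (use elim in blast)
      also have "\<dots> = ereal (W X / (\<rho> * (1 - \<rho>)))"
        unfolding W_def by (subst integral_divide_zero) (rule refl)
      finally show ?case .
    qed
    then have "ext_integral samples (\<lambda>X. ext_integral \<pi> (\<lambda>\<theta>. ereal (w_hat X \<theta>) * D_Re \<mu> \<rho> q (p \<theta>)))
        = ext_integral samples (\<lambda>X. ereal (W X / (\<rho> * (1 - \<rho>))))"
      by (rule ext_integral_cong_AE)
    also have "\<dots> = ereal (\<integral>X. W X / (\<rho> * (1 - \<rho>)) \<partial>samples)"
      by (rule ext_integral_ereal, rule integrable_divide) (rule W_int)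
    also have "\<dots> = ereal ((\<integral>X. W X \<partial>samples) / (\<rho> * (1 - \<rho>)))"
      by (subst integral_divide_zero) (rule refl)
    finally show "ext_integral samples (\<lambda>X. ext_integral \<pi> (\<lambda>\<theta>. ereal (w_hat X \<theta>) * D_Re \<mu> \<rho> q (p \<theta>)))
        = ereal ((\<integral>X. W X \<partial>samples) / (\<rho> * (1 - \<rho>)))" .
    show "ereal (\<gamma> - \<rho>) * ext_integral samples (\<lambda>X. R_hat q p \<pi> n lam' X (w_hat X))
        = ereal (\<integral>X. (\<gamma> - \<rho>) * F X \<partial>samples)"
    proof (cases "\<gamma> = \<rho>")
      case False
      then have "integrable samples F"
        using F_int \<gamma>_ge by simp
      then show ?thesis
        using ext_integral_cong_AE[OF R_hat_F] ext_integral_ereal[of samples F] by simp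
    qed (simp add: zero_ereal_def[symmetric])
    show "c_const \<mu> q p \<pi> n \<rho> \<alpha> = ereal (ln G / real n)"
      using \<open>0 < G\<close> by (simp add: c_const_affinity Gn_def[symmetric] G enn2ereal_ennreal eln_ereal)
    show "R_true \<mu> q p \<pi> n lam w = ereal (((\<integral>X. U0 X \<partial>samples) + lam * V0) / real n)"
      using competitor(3) by (simp add: U0_def V0_def)
    show "\<alpha> * \<rho> * (1 - \<rho>) * ((\<integral>X. W X \<partial>samples) / (\<rho> * (1 - \<rho>)))
        \<le> \<gamma> * (((\<integral>X. U0 X \<partial>samples) + lam * V0) / real n) - (\<integral>X. (\<gamma> - \<rho>) * F X \<partial>samples) + ln G / real n"
      using final \<rho>_range by simp
  qed
qed

end

text \<open>
  When a component of the bound is infinite in the favourable direction, so is the whole, thanks to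
  \<open>\<infinity> - \<infinity> = \<infinity>\<close>.
\<close>

lemma excess_bound_infinite:
  fixes I c E :: ereal and k \<gamma> \<rho> :: real
  assumes "0 < k" "0 < \<gamma>" "I = \<infinity> \<or> c = \<infinity> \<or> (\<rho> < \<gamma> \<and> E = -\<infinity>)"
  shows "ereal \<gamma> * I / ereal k - ereal ((\<gamma> - \<rho>) / k) * E + c / ereal k = \<infinity>"
proof -
  have I: "ereal \<gamma> * I / ereal k = \<infinity>" if "I = \<infinity>"
    using that assms by simp
  have E: "ereal ((\<gamma> - \<rho>) / k) * E = -\<infinity>" if "\<rho> < \<gamma>" "E = -\<infinity>"
    using that assms by (simp add: divide_less_0_iff)
  have c: "c / ereal k = \<infinity>" if "c = \<infinity>"
    using that assms by simp
  have "x - y + z = \<infinity>" if "x = \<infinity> \<or> y = -\<infinity> \<or> z = \<infinity>" for x y z :: ereal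
    using that by (cases x; cases y; cases z) auto
  then show ?thesis
    using assms(3) I E c by blast
qed

theorem theorem3p1:
  fixes \<mu> :: "'a measure" and q :: "'a \<Rightarrow> real"
    and \<pi> :: "'t measure" and p :: "'t \<Rightarrow> 'a \<Rightarrow> real"
    and n :: nat and S :: "('t \<Rightarrow> real) set" and w_hat :: "(nat \<Rightarrow> 'a) \<Rightarrow> 't \<Rightarrow> real"
    and lam lam' \<alpha> \<rho> \<gamma> :: real
  assumes q_density: "prob_density \<mu> q"
    and prior: "prob_space \<pi>"
    and p_density: "\<And>\<theta>. \<theta> \<in> space \<pi> \<Longrightarrow> prob_density \<mu> (p \<theta>)"
    and p_measurable: "(\<lambda>(x, \<theta>). p \<theta> x) \<in> borel_measurable (\<mu> \<Otimes>\<^sub>M \<pi>)"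
    and n_pos: "0 < n"
    and S_density: "\<And>w. w \<in> S \<Longrightarrow> prob_density \<pi> w"
    and lam_nonneg: "0 \<le> lam"
    and objective_defined:
      "AE X in sample_law \<mu> q n. \<forall>w\<in>S. icm_objective_defined p \<pi> n lam X w"
    and estimator: "AE X in sample_law \<mu> q n. is_icm_minimizer p \<pi> n lam S X (w_hat X)"
    and estimator_measurable:
      "(\<lambda>(X, \<theta>). w_hat X \<theta>) \<in> borel_measurable (sample_law \<mu> q n \<Otimes>\<^sub>M \<pi>)"
    and \<alpha>_pos: "0 < \<alpha>"
    and \<rho>_range: "0 < \<rho>" "\<rho> < 1"
    and \<gamma>_ge: "\<rho> \<le> \<gamma>"
    and \<gamma>_eq: "\<gamma> = \<rho> \<Longrightarrow> lam * \<gamma> = 1"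
    and lam'_eq: "lam' = (if \<gamma> = \<rho> then 0 else (lam * \<gamma> - 1) / (\<gamma> - \<rho>))"
    and lam'_nonneg: "0 \<le> lam'"
    and empirical_defined: "\<rho> < \<gamma> \<Longrightarrow>
      (AE X in sample_law \<mu> q n. R_hat_defined q p \<pi> n lam' X (w_hat X)) \<and>
      ext_integral_defined (sample_law \<mu> q n) (\<lambda>X. R_hat q p \<pi> n lam' X (w_hat X))"
    and bound_defined: "sum_defined
      {ereal \<gamma> * (INF w\<in>S. R_true \<mu> q p \<pi> n lam w),
       - (ereal (\<gamma> - \<rho>) * ext_integral (sample_law \<mu> q n) (\<lambda>X. R_hat q p \<pi> n lam' X (w_hat X))),
       c_const \<mu> q p \<pi> n \<rho> \<alpha>}"
  shows
    "ext_integral (sample_law \<mu> q n) (\<lambda>X. ext_integral \<pi>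
         (\<lambda>\<theta>. ereal (w_hat X \<theta>) * ereal (D_rho \<mu> \<rho> q (p \<theta>))))
     \<le> ext_integral (sample_law \<mu> q n) (\<lambda>X. ext_integral \<pi>
         (\<lambda>\<theta>. ereal (w_hat X \<theta>) * D_Re \<mu> \<rho> q (p \<theta>)))
     \<and>
     ext_integral (sample_law \<mu> q n) (\<lambda>X. ext_integral \<pi>
         (\<lambda>\<theta>. ereal (w_hat X \<theta>) * D_Re \<mu> \<rho> q (p \<theta>)))
     \<le> ereal \<gamma> * (INF w\<in>S. R_true \<mu> q p \<pi> n lam w) / ereal (\<alpha> * \<rho> * (1 - \<rho>))
       - ereal ((\<gamma> - \<rho>) / (\<alpha> * \<rho> * (1 - \<rho>))) *
           ext_integral (sample_law \<mu> q n) (\<lambda>X. R_hat q p \<pi> n lam' X (w_hat X))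
       + c_const \<mu> q p \<pi> n \<rho> \<alpha> / ereal (\<alpha> * \<rho> * (1 - \<rho>))
     \<and>
     c_const \<mu> q p \<pi> n \<rho> \<alpha> = ereal (1 / real n) *
       eln (ext_integral \<pi> (\<lambda>\<theta>.
         eexp (ereal (- \<rho> * (1 - \<rho>) * (1 - \<alpha>) * real n) * D_Re \<mu> \<rho> q (p \<theta>))))"
proof -
  interpret density_model \<mu> q \<pi> p n \<rho> \<alpha>
    by (intro density_model.intro q_density prior p_density p_measurable n_pos \<rho>_range \<alpha>_pos)
  let ?Rq = "ext_integral samples (\<lambda>X. ext_integral \<pi> (\<lambda>\<theta>. ereal (w_hat X \<theta>) * D_Re \<mu> \<rho> q (p \<theta>)))"
  define I E c where "I = (INF w\<in>S. R_true \<mu> q p \<pi> n lam w)"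
    and "E = ext_integral samples (\<lambda>X. R_hat q p \<pi> n lam' X (w_hat X))"
    and "c = c_const \<mu> q p \<pi> n \<rho> \<alpha>"
  let ?k = "\<alpha> * \<rho> * (1 - \<rho>)"
  have k: "0 < ?k"
    using \<alpha>_pos \<rho>_range by simp
  have \<gamma>_pos: "0 < \<gamma>"
    using \<gamma>_ge \<rho>_range by simp
  have weights: "(\<gamma> - \<rho>) * lam' = lam * \<gamma> - 1"
    using \<gamma>_eq by (cases "\<gamma> = \<rho>") (auto simp: lam'_eq)
  \<comment> \<open>For \<open>lam = 0\<close> the identity above would give \<open>(\<gamma> - \<rho>) * lam' = -1\<close>.\<close>
  have lam_pos: "0 < lam"
  proof -
    have "0 \<le> (\<gamma> - \<rho>) * lam'"
      using \<gamma>_ge lam'_nonneg by simp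
    then show ?thesis
      using weights lam_nonneg by (cases "lam = 0") auto
  qed

  have "ext_integral samples (\<lambda>X. ext_integral \<pi> (\<lambda>\<theta>. ereal (w_hat X \<theta>) * ereal (D_rho \<mu> \<rho> q (p \<theta>)))) \<le> ?Rq"
  proof (rule ext_integral_mono_AE, use estimator in eventually_elim)
    fix X assume "is_icm_minimizer p \<pi> n lam S X (w_hat X)"
    then have "prob_density \<pi> (w_hat X)"
      using S_density by (simp add: is_icm_minimizer_def is_arg_min_def)
    then show "ext_integral \<pi> (\<lambda>\<theta>. ereal (w_hat X \<theta>) * ereal (D_rho \<mu> \<rho> q (p \<theta>)))
        \<le> ext_integral \<pi> (\<lambda>\<theta>. ereal (w_hat X \<theta>) * D_Re \<mu> \<rho> q (p \<theta>))"
      by (intro ext_integral_mono_AE AE_I2 ereal_mult_left_mono D_rho_le_D_Re) (auto simp: prob_density_def)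
  qed
  moreover have "c = ereal (1 / real n) * eln (ext_integral \<pi> (\<lambda>\<theta>.
      eexp (ereal (- \<rho> * (1 - \<rho>) * (1 - \<alpha>) * real n) * D_Re \<mu> \<rho> q (p \<theta>))))"
    unfolding c_def c_const_def affinity_def[symmetric] epowr_affinity_eq_eexp ..
  moreover have "?Rq \<le> ereal \<gamma> * I / ereal ?k - ereal ((\<gamma> - \<rho>) / ?k) * E + c / ereal ?k"
  proof (cases "I = \<infinity> \<or> c = \<infinity> \<or> (\<rho> < \<gamma> \<and> E = -\<infinity>)")
    case True
    then show ?thesis
      using excess_bound_infinite[OF k \<gamma>_pos, of I c \<rho> E] by (simp only: ereal_less_eq)
  next
    case False
    note bound = icm_risk_bound[OF S_density lam_pos objective_defined estimator estimator_measurable \<gamma>_ge weights,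
        folded E_def c_def]
    have c_fin: "c < \<infinity>" and E_fin: "\<rho> < \<gamma> \<Longrightarrow> -\<infinity> < E" and I_fin: "I < \<infinity>"
      using False by (auto simp: less_le)
    obtain w where w: "w \<in> S" "R_true \<mu> q p \<pi> n lam w < \<infinity>"
      using I_fin unfolding I_def INF_less_iff by blast
    obtain T e c' where T: "?Rq = ereal T" and e: "ereal (\<gamma> - \<rho>) * E = ereal e" and c': "c = ereal c'"
      by (rule bound[OF _ w c_fin E_fin])
    have "ereal ((?k * T + e - c') / \<gamma>) \<le> I"
      unfolding I_def
    proof (rule INF_greatest)
      fix v assume v: "v \<in> S"
      show "ereal ((?k * T + e - c') / \<gamma>) \<le> R_true \<mu> q p \<pi> n lam v"
      proof (cases "R_true \<mu> q p \<pi> n lam v < \<infinity>")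
        case True
        obtain r where r: "R_true \<mu> q p \<pi> n lam v = ereal r" "?k * T \<le> \<gamma> * r - e + c'"
        proof (rule bound[OF _ v True c_fin E_fin])
          fix T1 e1 c1 r
          assume "?Rq = ereal T1" "ereal (\<gamma> - \<rho>) * E = ereal e1" "c = ereal c1"
            and *: "R_true \<mu> q p \<pi> n lam v = ereal r" "?k * T1 \<le> \<gamma> * r - e1 + c1"
          then have "T1 = T" "e1 = e" "c1 = c'"
            unfolding T e c' by (simp_all only: ereal.inject)
          with * show thesis
            by (intro that) simp_all
        qed
        then have "?k * T + e - c' \<le> r * \<gamma>"
          by (simp add: mult.commute)
        then show ?thesis
          unfolding r(1) ereal_less_eq using \<gamma>_pos by (simp only: pos_divide_le_eq)
      qed simp
    qed
    with I_fin obtain i where i: "I = ereal i" "(?k * T + e - c') / \<gamma> \<le> i"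
      by (cases I) auto
    have "ereal ((\<gamma> - \<rho>) / ?k) * E = ereal (1 / ?k) * (ereal (\<gamma> - \<rho>) * E)"
      unfolding mult.assoc[symmetric] times_ereal.simps by simp
    then have e': "ereal ((\<gamma> - \<rho>) / ?k) * E = ereal (e / ?k)"
      by (simp add: e)
    have "?k * T + e - c' \<le> i * \<gamma>"
      using i(2) \<gamma>_pos by (simp only: pos_divide_le_eq)
    then have "T * ?k \<le> \<gamma> * i - e + c'"
      by (simp add: mult.commute)
    then have "T \<le> (\<gamma> * i - e + c') / ?k"
      using k by (simp only: pos_le_divide_eq)
    then have "T \<le> \<gamma> * i / ?k - e / ?k + c' / ?k"
      by (simp only: diff_divide_distrib add_divide_distrib)
    moreover have "ereal x / ereal y = ereal (x / y)" if "0 < y" for x y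
      using that by simp
    note this[OF k]
    ultimately show ?thesis
      unfolding T i(1) c' e' by (simp only: times_ereal.simps ereal_minus plus_ereal.simps ereal_less_eq)
  qed
  ultimately show ?thesis
    unfolding I_def E_def c_def by blast
qed

end
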